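(* Let $\nu$ be a compactly supported Borel probability measure on $\mathbb{R}^d$ with support contained in $(0,1]^d$ and $\dim_\infty(\nu)>0$, and let $a_\nu=\sup\{q_r:r\in(-\dim_\infty(\nu),0)\}$. Then $$\dim_\infty(\nu)\le\lim_{r\searrow-\dim_\infty(\nu)}\underline{D}_r(\nu)=\frac{a_\nu}{a_\nu-1}\dim_\infty(\nu),$$ where $a_\nu/(a_\nu-1)$ is set to be $1$ whenever $a_\nu=+\infty$.
   Context: $\mathbb{R}^d$ carries a fixed norm $\|\cdot\|$; $d(x,A)=\min_{y\in A}\|x-y\|$; $\mathcal{A}_n=\{A\subset\mathbb{R}^d:1\le\operatorname{card}(A)\le n\}$. For $r<0$, $$\mathfrak{e}_{n,r}(\nu)=\inf_{A\in\mathcal{A}_n}\Big(\int d(x,A)^r\,d\nu(x)\Big)^{1/r}$$ (with $0^r=+\infty$, $(+\infty)^{1/r}=0$), and the lower quantization dimension of order $r$ is $$\underline{D}_r(\nu)=\liminf_{n\to\infty}\frac{\log n}{-\log\mathfrak{e}_{n,r}(\nu)}$$ (convention $1/\log0=0$). $\mathcal{D}_n$ is the partition of $(0,1]^d$ by half-open cubes $\prod_{i=1}^d(k_i2^{-n},(k_i+1)2^{-n}]$, $k\in\mathbb{Z}^d$; $\mathcal{D}=\bigcup_{n\in\mathbb{N}}\mathcal{D}_n$; $\mathcal{D}(Q)=\{Q'\in\mathcal{D}:Q'\subset Q\}$. $\Lambda$ is Lebesgue measure on $(0,1]^d$. $$\dim_\infty(\nu)=\liminf_{n\to\infty}\frac{\max_{Q\in\mathcal{D}_n}\log\nu(Q)}{\log2^{-n}}.$$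 For $r>-\dim_\infty(\nu)$, $Q\in\mathcal{D}$ and $q\ge0$, $$\mathfrak{J}_{\nu,r}(Q)=\max_{Q'\in\mathcal{D}(Q)}\nu(Q')\Lambda(Q')^{r/d},\qquad \tau_{\mathfrak{J}_{\nu,r}}(q)=\limsup_{n\to\infty}\frac{\log\sum_{Q\in\mathcal{D}_n,\ \mathfrak{J}_{\nu,r}(Q)>0}\mathfrak{J}_{\nu,r}(Q)^q}{\log2^n},$$ $$q_r=\inf\{q>0:\tau_{\mathfrak{J}_{\nu,r}}(q)<0\}.$$ *)

theory Defs
  imports "HOL-Probability.Probability"
begin

definition is_norm :: "(real ^ 'd \<Rightarrow> real) \<Rightarrow> bool" where
  "is_norm N \<longleftrightarrow>
     (\<forall>x. 0 \<le> N x) \<and> (\<forall>x. N x = 0 \<longleftrightarrow> x = 0) \<and>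
     (\<forall>c x. N (c *\<^sub>R x) = \<bar>c\<bar> * N x) \<and>
     (\<forall>x y. N (x + y) \<le> N x + N y)"

definition measure_support :: "'a::topological_space measure \<Rightarrow> 'a set" where
  "measure_support \<nu> = {x. \<forall>U. open U \<and> x \<in> U \<longrightarrow> emeasure \<nu> U > 0}"

text \<open>The logarithm on \<open>[0, \<infinity>]\<close> with \<open>log 0 = -\<infinity>\<close>. In \<^typ>\<open>ereal\<close> one has
  \<open>x / \<infinity> = 0\<close>, so the convention \<open>1 / log 0 = 0\<close> holds automatically below.\<close>

definition elog :: "ennreal \<Rightarrow> ereal" where
  "elog x = (if x = 0 then -\<infinity> else if x = \<infinity> then \<infinity> else ereal (ln (enn2real x)))"

text \<open>The power \<open>x\<^sup>s\<close> on \<open>[0, \<infinity>]\<close>, for exponents \<open>s < 0\<close> only.\<close>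

definition neg_powr :: "ennreal \<Rightarrow> real \<Rightarrow> ennreal" where
  "neg_powr x s = (if x = 0 then \<infinity> else if x = \<infinity> then 0 else ennreal (enn2real x powr s))"


subsection \<open>Quantization\<close>

definition dist_set :: "(real ^ 'd \<Rightarrow> real) \<Rightarrow> real ^ 'd \<Rightarrow> (real ^ 'd) set \<Rightarrow> real" where
  "dist_set N x A = Min ((\<lambda>y. N (x - y)) ` A)"

definition codebooks :: "nat \<Rightarrow> (real ^ 'd) set set" where
  "codebooks n = {A. finite A \<and> 1 \<le> card A \<and> card A \<le> n}"

definition quant_error ::
  "(real ^ 'd \<Rightarrow> real) \<Rightarrow> (real ^ 'd) measure \<Rightarrow> real \<Rightarrow> nat \<Rightarrow> ennreal" where
  "quant_error N \<nu> r n =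
     (INF A\<in>codebooks n.
        neg_powr (\<integral>\<^sup>+x. neg_powr (ennreal (dist_set N x A)) r \<partial>\<nu>) (1 / r))"

definition lower_quant_dim ::
  "(real ^ 'd \<Rightarrow> real) \<Rightarrow> (real ^ 'd) measure \<Rightarrow> real \<Rightarrow> ereal" where
  "lower_quant_dim N \<nu> r =
     Liminf sequentially (\<lambda>n. ereal (ln (real n)) / (- elog (quant_error N \<nu> r n)))"


subsection \<open>Dyadic cubes\<close>

definition unit_cube :: "(real ^ 'd) set" where
  "unit_cube = {x. \<forall>i. 0 < x $ i \<and> x $ i \<le> 1}"

definition dyadic_cube :: "nat \<Rightarrow> ('d \<Rightarrow> int) \<Rightarrow> (real ^ 'd) set" where
  "dyadic_cube n k =
     {x. \<forall>i. of_int (k i) / 2 ^ n < x $ i \<and> x $ i \<le> (of_int (k i) + 1) / 2 ^ n}"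

definition dyadic_level :: "nat \<Rightarrow> (real ^ 'd) set set" where
  "dyadic_level n = {dyadic_cube n k | k. dyadic_cube n k \<subseteq> unit_cube}"

definition dyadic_all :: "(real ^ 'd) set set" where
  "dyadic_all = (\<Union>n. dyadic_level n)"

definition dyadic_sub :: "(real ^ 'd) set \<Rightarrow> (real ^ 'd) set set" where
  "dyadic_sub Q = {Q' \<in> dyadic_all. Q' \<subseteq> Q}"

definition dim_infty :: "(real ^ 'd) measure \<Rightarrow> ereal" where
  "dim_infty \<nu> =
     Liminf sequentially
       (\<lambda>n. Max ((\<lambda>Q. elog (emeasure \<nu> Q)) ` dyadic_level n) / ereal (ln (1 / 2 ^ n)))"


subsection \<open>The partition function\<close>

definition J_val :: "(real ^ 'd) measure \<Rightarrow> real \<Rightarrow> (real ^ 'd) set \<Rightarrow> real" where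
  "J_val \<nu> r Q' = measure \<nu> Q' * measure lborel Q' powr (r / real CARD('d))"

text \<open>The index set of the maximum is infinite, hence not \<^const>\<open>Max\<close>. The maximum
  exists for \<open>r > - dim_infty \<nu>\<close>, see \<open>J_max_attained\<close> below.\<close>

definition J_max :: "(real ^ 'd) measure \<Rightarrow> real \<Rightarrow> (real ^ 'd) set \<Rightarrow> real" where
  "J_max \<nu> r Q = (GREATEST m. m \<in> J_val \<nu> r ` dyadic_sub Q)"

definition tau_J :: "(real ^ 'd) measure \<Rightarrow> real \<Rightarrow> real \<Rightarrow> ereal" where
  "tau_J \<nu> r q =
     Limsup sequentially
       (\<lambda>n. elog (ennreal (\<Sum>Q | Q \<in> dyadic_level n \<and> J_max \<nu> r Q > 0. J_max \<nu> r Q powr q))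
              / ereal (ln (2 ^ n)))"

definition q_crit :: "(real ^ 'd) measure \<Rightarrow> real \<Rightarrow> ereal" where
  "q_crit \<nu> r = Inf {ereal q | q. 0 < q \<and> tau_J \<nu> r q < 0}"

definition a_crit :: "(real ^ 'd) measure \<Rightarrow> ereal" where
  "a_crit \<nu> = Sup {q_crit \<nu> r | r. - dim_infty \<nu> < ereal r \<and> r < 0}"

text \<open>If \<open>dim_infty \<nu> > 0\<close> then \<open>a_crit \<nu> > 1\<close>, so the denominator is positive.\<close>

definition a_ratio :: "ereal \<Rightarrow> ereal" where
  "a_ratio a = (if a = \<infinity> then 1 else a / (a - 1))"


subsection \<open>Well-definedness\<close>

lemma dyadic_level_eq:
  "dyadic_level n = (dyadic_cube n ` {k :: 'd::finite \<Rightarrow> int. \<forall>i. k i \<in> {0..<2 ^ n}})"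
proof -
  have "dyadic_cube n k \<subseteq> unit_cube \<longleftrightarrow> (\<forall>i. k i \<in> {0..<2 ^ n})" for k :: "'d \<Rightarrow> int"
  proof
    assume sub: "dyadic_cube n k \<subseteq> unit_cube"
    show "\<forall>i. k i \<in> {0..<2 ^ n}"
    proof
      fix i
      define x :: "real ^ 'd" where "x = (\<chi> j. (of_int (k j) + 1) / 2 ^ n)"
      have "x \<in> dyadic_cube n k"
        by (auto simp: x_def dyadic_cube_def field_simps)
      then have "x \<in> unit_cube" using sub by blast
      then have "0 < (of_int (k i) + 1 :: real) / 2 ^ n" "(of_int (k i) + 1 :: real) / 2 ^ n \<le> 1"
        by (auto simp: x_def unit_cube_def)
      then have 1: "(0::real) < of_int (k i + 1)" "real_of_int (k i + 1) \<le> of_int (2 ^ n)"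
        by (auto simp: field_simps)
      have "0 < k i + 1" using 1(1) by linarith
      moreover have "k i + 1 \<le> 2 ^ n" using 1(2) of_int_le_iff by blast
      ultimately show "k i \<in> {0..<2 ^ n}" by simp
    qed
  next
    assume k: "\<forall>i. k i \<in> {0..<2 ^ n}"
    show "dyadic_cube n k \<subseteq> unit_cube"
    proof
      fix x assume x: "x \<in> dyadic_cube n k"
      show "x \<in> unit_cube"
        unfolding unit_cube_def
      proof (intro CollectI allI conjI)
        fix i
        have ki: "0 \<le> k i" "k i + 1 \<le> 2 ^ n" using k by (auto simp: zless_imp_add1_zle)
        have r: "(0::real) \<le> of_int (k i)" "real_of_int (k i + 1) \<le> of_int (2 ^ n)"
          using ki(1) ki(2) by (simp, subst of_int_le_iff, simp)
        have xi: "of_int (k i) / 2 ^ n < x $ i" "x $ i \<le> (of_int (k i) + 1) / 2 ^ n"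
          using x by (auto simp: dyadic_cube_def)
        have "0 \<le> (of_int (k i) :: real) / 2 ^ n" using r(1) by simp
        then show "0 < x $ i" using xi(1) by linarith
        have "(of_int (k i) + 1 :: real) / 2 ^ n \<le> 1" using r(2) by (simp add: field_simps)
        then show "x $ i \<le> 1" using xi(2) by linarith
      qed
    qed
  qed
  then show ?thesis by (auto simp: dyadic_level_def)
qed

lemma finite_dyadic_level: "finite (dyadic_level n :: (real ^ 'd::finite) set set)"
  and card_dyadic_level: "card (dyadic_level n :: (real ^ 'd::finite) set set) \<le> 2 ^ (n * CARD('d))"
proof -
  let ?K = "{k :: 'd \<Rightarrow> int. \<forall>i. k i \<in> {0..<2 ^ n}}"
  have K: "?K = (UNIV :: 'd set) \<rightarrow>\<^sub>E {0..<2 ^ n}"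
    by (auto simp: PiE_def Pi_def)
  have fin: "finite ?K" unfolding K by (intro finite_PiE) auto
  then show "finite (dyadic_level n :: (real ^ 'd) set set)"
    unfolding dyadic_level_eq by blast
  have "card ?K = 2 ^ (n * CARD('d))"
    unfolding K by (subst card_PiE) (auto simp: power_mult nat_power_eq)
  then show "card (dyadic_level n :: (real ^ 'd) set set) \<le> 2 ^ (n * CARD('d))"
    unfolding dyadic_level_eq using card_image_le[OF fin] by metis
qed

lemma dyadic_level_nonempty: "dyadic_level n \<noteq> ({} :: (real ^ 'd::finite) set set)"
proof -
  have "(\<lambda>_. 0) \<in> {k :: 'd \<Rightarrow> int. \<forall>i. k i \<in> {0..<2 ^ n}}" by simp
  then show ?thesis unfolding dyadic_level_eq image_is_empty by (metis empty_iff)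
qed

lemma Union_dyadic_level: "\<Union>(dyadic_level n) = (unit_cube :: (real ^ 'd::finite) set)"
proof
  show "\<Union>(dyadic_level n) \<subseteq> (unit_cube :: (real ^ 'd) set)"
    by (auto simp: dyadic_level_def)
  show "(unit_cube :: (real ^ 'd) set) \<subseteq> \<Union>(dyadic_level n)"
  proof
    fix x :: "real ^ 'd" assume x: "x \<in> unit_cube"
    define k where "k i = \<lceil>2 ^ n * x $ i\<rceil> - 1" for i
    have xi: "0 < x $ i" "x $ i \<le> 1" for i using x by (auto simp: unit_cube_def)
    have "k i \<in> {0..<2 ^ n}" for i
    proof -
      have "0 < \<lceil>2 ^ n * x $ i\<rceil>" using xi[of i] by simp
      moreover have "2 ^ n * x $ i \<le> of_int (2 ^ n)"
        using xi[of i] mult_left_mono[of "x $ i" 1 "2 ^ n"] by simp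
      then have "\<lceil>2 ^ n * x $ i\<rceil> \<le> 2 ^ n" using ceiling_le by blast
      ultimately show ?thesis by (simp add: k_def)
    qed
    moreover have "x \<in> dyadic_cube n k"
      unfolding dyadic_cube_def
    proof (intro CollectI allI conjI)
      fix i
      have "of_int (k i) < 2 ^ n * x $ i" "2 ^ n * x $ i \<le> of_int (k i) + 1"
        using ceiling_correct[of "2 ^ n * x $ i"] by (auto simp: k_def)
      then show "of_int (k i) / 2 ^ n < x $ i" "x $ i \<le> (of_int (k i) + 1) / 2 ^ n"
        by (auto simp: field_simps)
    qed
    ultimately show "x \<in> \<Union>(dyadic_level n)"
      unfolding dyadic_level_eq by blast
  qed
qed

lemma measurable_dyadic_cube: "dyadic_cube n k \<in> sets (borel :: (real ^ 'd::finite) measure)"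
proof -
  have "dyadic_cube n k = (\<Inter>i. {x :: real ^ 'd. of_int (k i) / 2 ^ n < x $ i} \<inter>
           {x. x $ i \<le> (of_int (k i) + 1) / 2 ^ n})"
    by (auto simp: dyadic_cube_def)
  also have "\<dots> \<in> sets borel"
  proof (intro sets.finite_INT sets.Int)
    fix i
    have "open {x :: real ^ 'd. of_int (k i) / 2 ^ n < x $ i}"
      by (intro open_Collect_less continuous_intros)
    then show "{x :: real ^ 'd. of_int (k i) / 2 ^ n < x $ i} \<in> sets borel" by simp
    have "closed {x :: real ^ 'd. x $ i \<le> (of_int (k i) + 1) / 2 ^ n}"
      by (intro closed_Collect_le continuous_intros)
    then show "{x :: real ^ 'd. x $ i \<le> (of_int (k i) + 1) / 2 ^ n} \<in> sets borel" by simp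
  qed auto
  finally show ?thesis .
qed

lemma emeasure_compl_support:
  fixes \<nu> :: "'a::second_countable_topology measure"
  assumes "sets \<nu> = sets borel"
  shows "- measure_support \<nu> \<in> null_sets \<nu>"
proof -
  let ?F = "{U. open U \<and> emeasure \<nu> U = 0}"
  obtain F where F: "F \<subseteq> ?F" "countable F" "\<Union>F = \<Union>?F"
    by (rule Lindelof[of ?F]) auto
  have "\<Union>F \<in> null_sets \<nu>"
  proof -
    have "(\<Union>U\<in>F. U) \<in> null_sets \<nu>"
      using F(1,2) assms by (intro null_sets_UN') (auto simp: null_sets_def)
    then show ?thesis by simp
  qed
  moreover have "- measure_support \<nu> = \<Union>?F"
    by (auto simp: measure_support_def zero_less_iff_neq_zero)
  ultimately show ?thesis using F(3) by simp
qed

lemma max_cube_lower: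
  fixes \<nu> :: "(real ^ 'd::finite) measure"
  assumes "prob_space \<nu>" and sets: "sets \<nu> = sets borel" and sup: "measure_support \<nu> \<subseteq> unit_cube"
  shows "\<exists>Q \<in> dyadic_level n. 1 / 2 ^ (n * CARD('d)) \<le> measure \<nu> Q"
proof (rule ccontr)
  interpret prob_space \<nu> by fact
  let ?D = "dyadic_level n :: (real ^ 'd) set set"
  assume "\<not> ?thesis"
  then have less: "measure \<nu> Q < 1 / 2 ^ (n * CARD('d))" if "Q \<in> ?D" for Q
    using that by force
  have meas: "Q \<in> sets \<nu>" if "Q \<in> ?D" for Q
    using that measurable_dyadic_cube sets by (auto simp: dyadic_level_def)
  have "AE x in \<nu>. x \<in> unit_cube"
    using emeasure_compl_support[OF sets] sup by (intro AE_I') auto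
  moreover have "(unit_cube :: (real ^ 'd) set) \<in> sets \<nu>"
    unfolding Union_dyadic_level[of n, symmetric]
    by (intro sets.finite_Union finite_dyadic_level) (use meas in auto)
  ultimately have "1 = measure \<nu> (\<Union>?D)"
    by (subst Union_dyadic_level) (simp add: prob_eq_1)
  also have "\<dots> \<le> (\<Sum>Q\<in>?D. measure \<nu> Q)"
    using measure_UNION_le[of ?D "\<lambda>x. x" \<nu>] finite_dyadic_level[of n] meas by auto
  also have "\<dots> < (\<Sum>Q\<in>?D. 1 / 2 ^ (n * CARD('d)))"
    by (intro sum_strict_mono finite_dyadic_level dyadic_level_nonempty less)
  also have "\<dots> = real (card ?D) / 2 ^ (n * CARD('d))" by simp
  also have "\<dots> \<le> 1"
  proof -
    have "real (card ?D) \<le> real (2 ^ (n * CARD('d)))"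
      using card_dyadic_level by (rule of_nat_mono)
    then show ?thesis by simp
  qed
  finally show False by simp
qed

text \<open>In particular \<open>dim_infty \<nu>\<close> is a real number, which justifies the use of
  \<^const>\<open>real_of_ereal\<close> when a real parameter tends to it.\<close>

lemma dim_infty_bounds:
  fixes \<nu> :: "(real ^ 'd::finite) measure"
  assumes "prob_space \<nu>" and "sets \<nu> = sets borel" and "measure_support \<nu> \<subseteq> unit_cube"
  shows "0 \<le> dim_infty \<nu>" and "dim_infty \<nu> \<le> ereal (real CARD('d))"
proof -
  interpret prob_space \<nu> by fact
  let ?D = "\<lambda>n. dyadic_level n :: (real ^ 'd) set set"
  let ?M = "\<lambda>n. Max ((\<lambda>Q. elog (emeasure \<nu> Q)) ` ?D n)"
  let ?q = "\<lambda>n. ?M n / ereal (ln (1 / 2 ^ n))"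
  have q: "0 \<le> ?q n \<and> ?q n \<le> ereal (real CARD('d))" if n: "n > 0" for n
  proof -
    have fin: "finite ((\<lambda>Q. elog (emeasure \<nu> Q)) ` ?D n)" "(\<lambda>Q. elog (emeasure \<nu> Q)) ` ?D n \<noteq> {}"
      using finite_dyadic_level dyadic_level_nonempty by auto
    have "elog (emeasure \<nu> Q) \<le> 0" for Q
      by (auto simp: elog_def emeasure_eq_measure ennreal_eq_0_iff not_le)
    then have up: "?M n \<le> 0" using fin by (subst Max_le_iff) auto
    obtain Q where Q: "Q \<in> ?D n" "1 / 2 ^ (n * CARD('d)) \<le> measure \<nu> Q"
      using max_cube_lower[OF assms] by blast
    have pos: "0 < measure \<nu> Q" by (rule less_le_trans[OF _ Q(2)]) simp
    have "ln (1 / 2 ^ (n * CARD('d))) \<le> ln (measure \<nu> Q)" using Q(2) pos by (subst ln_le_cancel_iff) auto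
    then have "- (real n * real CARD('d) * ln 2) \<le> ln (measure \<nu> Q)" by (simp add: ln_div ln_realpow)
    then have "ereal (- (real n * real CARD('d) * ln 2)) \<le> elog (emeasure \<nu> Q)"
      using pos by (simp add: elog_def emeasure_eq_measure ennreal_eq_0_iff)
    also have "\<dots> \<le> ?M n" using fin Q(1) by (intro Max_ge) auto
    finally have lo: "ereal (- (real n * real CARD('d) * ln 2)) \<le> ?M n" .
    obtain m where m: "?M n = ereal m" using lo up by (cases "?M n") auto
    have l: "ln (1 / 2 ^ n) = - (real n * ln 2)" by (simp add: ln_div ln_realpow)
    show ?thesis using lo up n unfolding m l
      by (auto simp: field_simps divide_nonpos_neg)
  qed
  show "0 \<le> dim_infty \<nu>" unfolding dim_infty_def
    by (intro Liminf_bounded eventually_sequentiallyI[of 1]) (use q in auto)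
  have "dim_infty \<nu> \<le> Limsup sequentially ?q"
    unfolding dim_infty_def by (intro Liminf_le_Limsup) simp
  also have "\<dots> \<le> ereal (real CARD('d))"
    by (intro Limsup_bounded eventually_sequentiallyI[of 1]) (use q in auto)
  finally show "dim_infty \<nu> \<le> ereal (real CARD('d))" .
qed

lemma measure_lborel_dyadic_cube:
  "measure lborel (dyadic_cube n k :: (real ^ 'd::finite) set) = (1 / 2 ^ n) ^ CARD('d)"
proof -
  define a b :: "real ^ 'd" where "a = (\<chi> i. of_int (k i) / 2 ^ n)"
    and "b = (\<chi> i. (of_int (k i) + 1) / 2 ^ n)"
  have sub: "box a b \<subseteq> dyadic_cube n k" "dyadic_cube n k \<subseteq> cbox a b"
    by (auto simp: mem_box_cart a_def b_def dyadic_cube_def less_imp_le)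
  have ab: "b $ i - a $ i = 1 / 2 ^ n" for i
    by (simp add: a_def b_def diff_divide_distrib[symmetric])
  have "a $ i \<le> b $ i" for i by (simp add: a_def b_def divide_right_mono)
  then have "measure lborel (cbox a b) = (1 / 2 ^ n) ^ CARD('d)"
    by (subst content_cbox_cart) (auto simp: ab interval_ne_empty_cart)
  moreover have "measure lborel (box a b) = measure lborel (cbox a b)"
    by (simp add: measure_lborel_box_eq measure_lborel_cbox_eq)
  moreover have "measure lborel (box a b) \<le> measure lborel (dyadic_cube n k :: (real ^ 'd) set)"
    using sub measurable_dyadic_cube
    by (intro measure_mono_fmeasurable) (auto intro!: fmeasurableI2[OF fmeasurable_cbox sub(2)])
  moreover have "measure lborel (dyadic_cube n k :: (real ^ 'd) set) \<le> measure lborel (cbox a b)"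
    using sub measurable_dyadic_cube
    by (intro measure_mono_fmeasurable) (auto intro!: fmeasurable_cbox)
  ultimately show ?thesis by linarith
qed

lemma J_val_level:
  fixes \<nu> :: "(real ^ 'd::finite) measure"
  assumes "Q \<in> dyadic_level n"
  shows "J_val \<nu> r Q = measure \<nu> Q * 2 powr (- (real n * r))"
proof -
  obtain k where Q: "Q = dyadic_cube n k" using assms by (auto simp: dyadic_level_def)
  have "(1 / 2 ^ n :: real) ^ CARD('d) = 2 powr (- (real n * real CARD('d)))"
    by (simp add: powr_minus powr_realpow[symmetric] powr_powr power_one_over inverse_eq_divide)
  then show ?thesis
    unfolding J_val_def Q measure_lborel_dyadic_cube by (simp add: powr_powr)
qed

lemma J_max_attained:
  fixes \<nu> :: "(real ^ 'd::finite) measure"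
  assumes "prob_space \<nu>" and r: "- dim_infty \<nu> < ereal r" and Q: "Q \<in> dyadic_all"
  shows "J_max \<nu> r Q \<in> J_val \<nu> r ` dyadic_sub Q"
    and "Q' \<in> dyadic_sub Q \<Longrightarrow> J_val \<nu> r Q' \<le> J_max \<nu> r Q"
proof -
  interpret prob_space \<nu> by fact
  let ?D = "\<lambda>n. dyadic_level n :: (real ^ 'd) set set"
  let ?M = "\<lambda>n. Max ((\<lambda>Q. elog (emeasure \<nu> Q)) ` ?D n)"
  have "ereal (- r) < dim_infty \<nu>" using r by (cases "dim_infty \<nu>") auto
  then obtain \<delta> where \<delta>: "- r < \<delta>" "ereal \<delta> < dim_infty \<nu>"
    using ereal_dense2 less_ereal.simps(1) by blast
  have "eventually (\<lambda>n. ereal \<delta> < ?M n / ereal (ln (1 / 2 ^ n))) sequentially"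
    using \<delta>(2) unfolding dim_infty_def by (rule less_LiminfD)
  then have ev: "eventually (\<lambda>n. \<forall>Q\<in>?D n. J_val \<nu> r Q \<le> 2 powr (- ((\<delta> + r) * real n))) sequentially"
    using eventually_gt_at_top[of 0]
  proof eventually_elim
    case (elim n)
    show ?case
    proof
      fix Q assume Q: "Q \<in> ?D n"
      have "measure \<nu> Q \<le> 2 powr (- (\<delta> * real n))"
      proof (cases "measure \<nu> Q = 0")
        case False
        then have pos: "0 < measure \<nu> Q" by (simp add: zero_less_measure_iff)
        have fin: "finite ((\<lambda>Q. elog (emeasure \<nu> Q)) ` ?D n)"
            "(\<lambda>Q. elog (emeasure \<nu> Q)) ` ?D n \<noteq> {}"
          using finite_dyadic_level dyadic_level_nonempty by auto
        have "elog (emeasure \<nu> Q) \<le> 0" for Q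
          by (auto simp: elog_def emeasure_eq_measure ennreal_eq_0_iff not_le)
        then have up: "?M n \<le> 0" using fin by (subst Max_le_iff) auto
        have "ereal (ln (measure \<nu> Q)) = elog (emeasure \<nu> Q)"
          using pos by (simp add: elog_def emeasure_eq_measure ennreal_eq_0_iff)
        also have "\<dots> \<le> ?M n" using fin Q by (intro Max_ge) auto
        finally have lo: "ereal (ln (measure \<nu> Q)) \<le> ?M n" .
        obtain m where m: "?M n = ereal m" using lo up by (cases "?M n") auto
        have l: "ln (1 / 2 ^ n) = - (real n * ln 2)" by (simp add: ln_div ln_realpow)
        have p: "0 < real n * ln 2" using elim(2) by simp
        have "\<delta> < m / (- (real n * ln 2))" using elim unfolding m l by simp
        then have "\<delta> * (real n * ln 2) < - m" using p by (simp add: field_simps)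
        then have "ln (measure \<nu> Q) \<le> - (\<delta> * real n) * ln 2" using lo m by (simp add: field_simps)
        then have "exp (ln (measure \<nu> Q)) \<le> exp (- (\<delta> * real n) * ln 2)" by (subst exp_le_cancel_iff)
        then show ?thesis using pos by (simp add: powr_def)
      qed simp
      then have "J_val \<nu> r Q \<le> 2 powr (- (\<delta> * real n)) * 2 powr (- (real n * r))"
        unfolding J_val_level[OF Q] by (intro mult_right_mono) auto
      also have "\<dots> = 2 powr (- ((\<delta> + r) * real n))"
        by (simp add: powr_add[symmetric] algebra_simps)
      finally show "J_val \<nu> r Q \<le> 2 powr (- ((\<delta> + r) * real n))" .
    qed
  qed
  have QQ: "Q \<in> dyadic_sub Q" using Q by (simp add: dyadic_sub_def)
  have nonneg: "0 \<le> J_val \<nu> r Q'" for Q' by (simp add: J_val_def)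
  have "\<exists>m. m \<in> J_val \<nu> r ` dyadic_sub Q \<and> (\<forall>y \<in> J_val \<nu> r ` dyadic_sub Q. y \<le> m)"
  proof (cases "\<forall>Q'\<in>dyadic_sub Q. J_val \<nu> r Q' = 0")
    case True
    then show ?thesis using QQ by (intro exI[of _ 0]) force
  next
    case False
    then obtain P where P: "P \<in> dyadic_sub Q" "J_val \<nu> r P \<noteq> 0" by blast
    define v where "v = J_val \<nu> r P"
    have v: "0 < v" using P nonneg[of P] by (simp add: v_def)
    have "((\<lambda>n. 2 powr (- ((\<delta> + r) * real n))) \<longlonglongrightarrow> (0::real))"
    proof -
      have "(2::real) powr (- (\<delta> + r)) < 2 powr 0"
        using \<delta>(1) by (intro powr_less_mono) auto
      then have "(\<lambda>n. (2 powr (- (\<delta> + r))) ^ n) \<longlonglongrightarrow> (0::real)"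
        by (intro LIMSEQ_power_zero) simp
      moreover have "(2 powr (- (\<delta> + r))) ^ n = (2::real) powr (- ((\<delta> + r) * real n))" for n
        by (simp add: powr_realpow[symmetric] powr_powr algebra_simps)
      ultimately show ?thesis by simp
    qed
    then have "eventually (\<lambda>n. 2 powr (- ((\<delta> + r) * real n)) < v) sequentially"
      using v by (rule order_tendstoD)
    with ev have "eventually (\<lambda>n. \<forall>Q\<in>?D n. J_val \<nu> r Q < v) sequentially"
      by eventually_elim force
    then obtain n0 where n0: "\<And>n Q. n \<ge> n0 \<Longrightarrow> Q \<in> ?D n \<Longrightarrow> J_val \<nu> r Q < v"
      by (auto simp: eventually_sequentially)
    let ?S = "{Q' \<in> dyadic_sub Q. v \<le> J_val \<nu> r Q'}"
    have "?S \<subseteq> (\<Union>n<n0. ?D n)"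
      using n0 by (fastforce simp: dyadic_sub_def dyadic_all_def not_less[symmetric])
    then have "finite ?S" by (rule finite_subset) (auto simp: finite_dyadic_level)
    then have fin: "finite (J_val \<nu> r ` ?S)" by simp
    have PS: "v \<in> J_val \<nu> r ` ?S" using P by (auto simp: v_def)
    let ?m = "Max (J_val \<nu> r ` ?S)"
    have "?m \<in> J_val \<nu> r ` ?S" using fin PS by (intro Max_in) auto
    moreover have "y \<le> ?m" if "y \<in> J_val \<nu> r ` dyadic_sub Q" for y
    proof (cases "v \<le> y")
      case True
      then show ?thesis using that fin by (intro Max_ge) auto
    next
      case False
      then show ?thesis using Max_ge[OF fin PS] by linarith
    qed
    ultimately show ?thesis by blast
  qed
  then obtain m where m: "m \<in> J_val \<nu> r ` dyadic_sub Q"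
    "\<And>y. y \<in> J_val \<nu> r ` dyadic_sub Q \<Longrightarrow> y \<le> m" by blast
  have "J_max \<nu> r Q = m"
    unfolding J_max_def using m by (intro Greatest_equality) auto
  then show "J_max \<nu> r Q \<in> J_val \<nu> r ` dyadic_sub Q"
    and "Q' \<in> dyadic_sub Q \<Longrightarrow> J_val \<nu> r Q' \<le> J_max \<nu> r Q"
    using m by auto
qed

end

theory Submission
  imports Defs "HOL-Real_Asymp.Real_Asymp"
begin

text \<open>
  Write \<open>d\<close> for the dimension of the space. For every \<open>r\<close> with \<open>- dim_infty \<nu> < r < 0\<close> the lower
  quantization dimension equals \<open>- r * (q / (q - 1))\<close> with \<open>q = q_crit \<nu> r\<close>, and \<open>1 < q < \<infinity>\<close>. As \<open>q\<close>
  is decreasing in \<open>r\<close>, it increases to \<open>a_crit \<nu>\<close> when \<open>r\<close> decreases to \<open>- dim_infty \<nu>\<close>, and continuity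
  of \<open>a / (a - 1)\<close> on \<open>(1, \<infinity>]\<close> gives the limit. The bound from below holds because \<open>a / (a - 1) \<ge> 1\<close>.

  Since \<open>r < 0\<close>, a small quantization error means a large energy, that is, a large integral of
  \<open>dist powr r\<close>. If \<open>E n\<close> is the supremum of the energies of codebooks with at most \<open>n\<close> points, the
  lower quantization dimension is the lower limit of \<open>- r * ln n / ln (E n)\<close>. So the formula says that
  the smallest growth exponent \<open>\<theta>\<close> with \<open>E n = O(n powr \<theta>)\<close>, up to arbitrarily small losses, is
  \<open>1 - 1 / q\<close>. Both directions are direct estimates on dyadic cubes.

  \<^item> Lemma \<open>energy_lower_bound\<close> places one point in the best subcube of each of the \<open>m\<close> largest cubes \<open>Q\<close>
    of a level, largest in the sense of \<open>J_max \<nu> r Q\<close>. The energy is then at least \<open>m\<close> times the \<open>m\<close>-th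
    largest value, up to a constant. Hence \<open>E n = O(n powr \<theta>)\<close> forces that value to be
    \<open>O(m powr (\<theta> - 1))\<close> uniformly in the level, so \<open>\<Sum> (J_max \<nu> r Q) powr p\<close> over a level is bounded for
    \<open>p > 1 / (1 - \<theta>)\<close>. The exponential decay of \<open>J_max\<close> in the level turns boundedness into decay at the
    cost of an arbitrarily small increase of \<open>p\<close>; this is lemma \<open>q_crit_le_of_energy_growth\<close>.

  \<^item> Lemma \<open>energy_upper_bound\<close> cuts the energy of a codebook with \<open>n\<close> points into the layers where the
    distance is about \<open>2 powr (- k)\<close>. Such a layer meets only \<open>O(n)\<close> cubes of level \<open>k\<close>, and Hoelder's
    inequality bounds its energy by
    \<open>O(n powr (1 - 1 / p)) * (\<Sum> (J_max \<nu> r Q) powr p) powr (1 / p)\<close>. If \<open>tau_J \<nu> r p < 0\<close>, the last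
    factor decays exponentially in \<open>k\<close>, and the layers can be summed.

  That \<open>q > 1\<close> comes from convexity: the mass of \<open>\<nu>\<close> is distributed over at most \<open>2 ^ (n * d)\<close> cubes of
  level \<open>n\<close>, whence \<open>q \<ge> d / (d + r)\<close>.
\<close>

section \<open>Powers, logarithms and finite sums\<close>

lemma neg_powr_ennreal:
  assumes "0 < x"
  shows "neg_powr (ennreal x) s = ennreal (x powr s)"
  using assms by (auto simp: neg_powr_def ennreal_eq_0_iff)

lemma neg_powr_antimono:
  assumes "s < 0" and "x \<le> y"
  shows "neg_powr y s \<le> neg_powr x s"
proof (cases "x = 0 \<or> y = \<infinity>")
  case True
  then show ?thesis using assms by (auto simp: neg_powr_def)
next
  case False
  then obtain b where b: "y = ennreal b" "0 \<le> b" by (cases y) auto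
  with False assms obtain a where a: "x = ennreal a" "0 \<le> a"
    by (cases x) (auto simp: top_unique)
  have ab: "0 < a" "a \<le> b" using a b False assms by (auto simp: less_le)
  show ?thesis using ab assms a b
    by (simp add: neg_powr_ennreal ennreal_leI powr_mono2')
qed

lemma elog_ennreal: "0 < x \<Longrightarrow> elog (ennreal x) = ereal (ln x)"
  by (simp add: elog_def ennreal_eq_0_iff)

lemma elog_mono: "x \<le> y \<Longrightarrow> elog x \<le> elog y"
  by (cases x; cases y) (auto simp: elog_def ennreal_eq_0_iff top_unique not_le)

text \<open>Hoelder's inequality with the threshold \<open>t\<close> left free: a term above \<open>t\<close> is at most
  \<open>f i powr p * t powr (1 - p)\<close>, and the others contribute at most \<open>t\<close> each. Choosing \<open>t\<close> to balance
  the two parts recovers the bound \<open>card F powr (1 - 1 / p) * (\<Sum>i\<in>F. f i powr p) powr (1 / p)\<close>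
  up to a constant factor.\<close>

lemma sum_le_threshold:
  fixes f :: "'a \<Rightarrow> real"
  assumes "finite F" and "\<And>i. i \<in> F \<Longrightarrow> 0 \<le> f i" and "0 < t" and "1 \<le> p"
  shows "(\<Sum>i\<in>F. f i) \<le> real (card F) * t + t powr (1 - p) * (\<Sum>i\<in>F. f i powr p)"
proof -
  have "f i \<le> t + t powr (1 - p) * f i powr p" if i: "i \<in> F" for i
  proof (cases "f i \<le> t")
    case True
    then show ?thesis by (smt (verit) mult_nonneg_nonneg powr_ge_zero)
  next
    case False
    then have "f i = f i powr (1 - p) * f i powr p"
      using assms(3) by (simp add: powr_add[symmetric])
    also have "\<dots> \<le> t powr (1 - p) * f i powr p"
      using False assms by (intro mult_right_mono powr_mono2') auto
    finally show ?thesis using assms(3) by linarith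
  qed
  then have "(\<Sum>i\<in>F. f i) \<le> (\<Sum>i\<in>F. t + t powr (1 - p) * f i powr p)" by (rule sum_mono)
  then show ?thesis by (simp add: sum.distrib sum_distrib_left)
qed

text \<open>The hypothesis on subsets says that the \<open>m\<close>-th largest value of \<open>f\<close> is at most
  \<open>K * m powr b\<close>; in this form no enumeration of \<open>S\<close> has to be chosen. Removing an element
  bounded in this way again and again compares \<open>\<Sum> f powr p\<close> with a \<open>p\<close>-series.\<close>

lemma sum_powr_le_of_ranked_bound:
  fixes f :: "'a \<Rightarrow> real"
  assumes "finite S" and "\<And>i. i \<in> S \<Longrightarrow> 0 \<le> f i" and "0 \<le> K" and "0 < p"
    and ranked: "\<And>T. T \<subseteq> S \<Longrightarrow> T \<noteq> {} \<Longrightarrow> \<exists>i\<in>T. f i \<le> K * real (card T) powr b"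
  shows "(\<Sum>i\<in>S. f i powr p) \<le> K powr p * (\<Sum>m\<in>{1..card S}. real m powr (b * p))"
proof -
  have "(\<Sum>i\<in>T. f i powr p) \<le> K powr p * (\<Sum>m\<in>{1..card T}. real m powr (b * p))"
    if "T \<subseteq> S" "card T = n" for T n
    using that
  proof (induction n arbitrary: T)
    case 0
    then have "T = {}" using assms(1) by (metis card_0_eq finite_subset)
    then show ?case by simp
  next
    case (Suc n)
    then have fin: "finite T" "T \<noteq> {}" using assms(1) finite_subset by auto
    obtain i where i: "i \<in> T" "f i \<le> K * real (card T) powr b" using ranked Suc fin by blast
    have c: "card (T - {i}) = n" using fin i Suc by simp
    have "f i powr p \<le> (K * real (card T) powr b) powr p"
      using i Suc assms by (intro powr_mono2) auto
    also have "\<dots> = K powr p * real (card T) powr (b * p)"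
      using assms by (simp add: powr_mult powr_powr)
    finally have le: "f i powr p \<le> K powr p * real (Suc n) powr (b * p)" using Suc by simp
    have "(\<Sum>i\<in>T. f i powr p) = f i powr p + (\<Sum>j\<in>T - {i}. f j powr p)"
      using fin i by (simp add: sum.remove)
    also have "\<dots> \<le> K powr p * real (Suc n) powr (b * p)
        + K powr p * (\<Sum>m\<in>{1..n}. real m powr (b * p))"
      using le Suc.IH[of "T - {i}"] Suc.prems c by (intro add_mono) auto
    also have "\<dots> = K powr p * (\<Sum>m\<in>{1..Suc n}. real m powr (b * p))"
      by (simp add: algebra_simps)
    finally show ?case using Suc by simp
  qed
  then show ?thesis by simp
qed

section \<open>Comparing a norm with coordinates\<close>

lemma is_norm_le_coords:
  fixes N :: "real ^ 'd \<Rightarrow> real"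
  assumes "is_norm N"
  obtains C where "0 < C" and "\<And>x \<delta>. (\<And>i. \<bar>x $ i\<bar> \<le> \<delta>) \<Longrightarrow> N x \<le> C * \<delta>"
proof -
  have hom: "N (c *\<^sub>R x) = \<bar>c\<bar> * N x" and tri: "N (x + y) \<le> N x + N y" and "0 \<le> N x" "N 0 = 0"
    for c x y using assms by (auto simp: is_norm_def)
  let ?S = "\<Sum>i\<in>UNIV. N (axis i 1)"
  have tri_sum: "N (sum g F) \<le> (\<Sum>i\<in>F. N (g i))" if "finite F" for g and F :: "'d set"
    using that
  proof induction
    case (insert i F)
    then show ?case using tri[of "g i" "sum g F"] by simp
  qed (simp add: \<open>N 0 = 0\<close>)
  show ?thesis
  proof (rule that[of "?S + 1"])
    show "0 < ?S + 1" using sum_nonneg[of UNIV "\<lambda>i. N (axis i 1)"] \<open>\<And>x. 0 \<le> N x\<close> by fastforce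
    fix x :: "real ^ 'd" and \<delta>
    assume \<delta>: "\<And>i. \<bar>x $ i\<bar> \<le> \<delta>"
    have d0: "0 \<le> \<delta>" using \<delta>[of undefined] by linarith
    have "x = (\<Sum>i\<in>UNIV. x $ i *\<^sub>R axis i 1)"
      using basis_expansion[of x] by (simp add: scalar_mult_eq_scaleR)
    then have "N x \<le> (\<Sum>i\<in>UNIV. N (x $ i *\<^sub>R axis i 1))" using tri_sum by (metis finite)
    also have "\<dots> \<le> (\<Sum>i\<in>UNIV. \<delta> * N (axis i 1))"
      unfolding hom using \<delta> \<open>\<And>x. 0 \<le> N x\<close> by (intro sum_mono mult_right_mono) auto
    also have "\<dots> \<le> (?S + 1) * \<delta>" using d0 by (simp add: sum_distrib_left[symmetric] algebra_simps)
    finally show "N x \<le> (?S + 1) * \<delta>" .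
  qed
qed

text \<open>All norms on a finite-dimensional space are equivalent: \<open>N\<close> is continuous and positive on the
  compact Euclidean unit sphere, hence bounded below there.\<close>

lemma coords_le_is_norm:
  fixes N :: "real ^ 'd \<Rightarrow> real"
  assumes "is_norm N"
  obtains B where "0 < B" and "\<And>x i. \<bar>x $ i\<bar> \<le> B * N x"
proof -
  have hom: "N (c *\<^sub>R x) = \<bar>c\<bar> * N x" and tri: "N (x + y) \<le> N x + N y" and nn: "0 \<le> N x"
    and z: "N x = 0 \<longleftrightarrow> x = 0" for c x y using assms by (auto simp: is_norm_def)
  obtain C where C: "0 < C" "\<And>x \<delta>. (\<And>i. \<bar>x $ i\<bar> \<le> \<delta>) \<Longrightarrow> N x \<le> C * \<delta>"
    using is_norm_le_coords[OF assms] by metis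
  have up: "N x \<le> C * norm x" for x using C(2)[of x "norm x"] component_le_norm_cart by blast
  have "continuous_on UNIV N"
  proof (rule continuous_onI)
    fix x :: "real ^ 'd" and e :: real assume "0 < e"
    have "dist (N y) (N x) \<le> e" if "dist y x < e / C" for y
    proof -
      have "N y \<le> N x + N (y - x)" "N x \<le> N y + N (x - y)" using tri[of x "y - x"] tri[of y "x - y"] by auto
      moreover have "N (y - x) \<le> C * dist y x" "N (x - y) \<le> C * dist y x"
        using up[of "y - x"] up[of "x - y"] by (auto simp: dist_norm norm_minus_commute)
      moreover have "C * dist y x \<le> e" using that C(1) by (simp add: field_simps)
      ultimately show ?thesis by (simp add: dist_real_def)
    qed
    then show "\<exists>d>0. \<forall>x'\<in>UNIV. dist x' x < d \<longrightarrow> dist (N x') (N x) \<le> e"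
      using \<open>0 < e\<close> C(1) by (intro exI[of _ "e / C"]) auto
  qed
  then have cont: "continuous_on (sphere 0 1) N" using continuous_on_subset by blast
  have "norm (axis undefined 1 :: real ^ 'd) = 1" by simp
  then have ne: "sphere (0 :: real ^ 'd) 1 \<noteq> {}" by (metis empty_iff mem_sphere_0)
  obtain u where u: "u \<in> sphere 0 1" "\<And>x. x \<in> sphere 0 1 \<Longrightarrow> N u \<le> N x"
    using continuous_attains_inf[OF compact_sphere ne cont] by blast
  have pos: "0 < N u" using u(1) z[of u] nn[of u] by (auto simp: less_le)
  show ?thesis
  proof (rule that[of "1 / N u"])
    show "0 < 1 / N u" using pos by simp
    fix x i
    have "N u * norm x \<le> N x"
    proof (cases "x = 0")
      case False
      have "N u \<le> N ((1 / norm x) *\<^sub>R x)" using False by (intro u) simp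
      then show ?thesis using False by (simp add: hom field_simps)
    qed (simp add: nn)
    moreover have "\<bar>x $ i\<bar> \<le> norm x" by (rule component_le_norm_cart)
    ultimately show "\<bar>x $ i\<bar> \<le> 1 / N u * N x"
      using pos by (simp add: field_simps) (smt (verit) mult_left_mono mult.commute)
  qed
qed

section \<open>Dyadic cubes\<close>

lemma dyadic_cube_index:
  assumes "x \<in> dyadic_cube n k"
  shows "k i = \<lceil>2 ^ n * x $ i\<rceil> - 1"
proof -
  have "of_int (k i) < 2 ^ n * x $ i" "2 ^ n * x $ i \<le> of_int (k i) + 1"
    using assms by (auto simp: dyadic_cube_def field_simps)
  then show ?thesis by linarith
qed

lemma dyadic_level_disjoint:
  assumes "Q \<in> dyadic_level n" "Q' \<in> dyadic_level n" "x \<in> Q" "x \<in> Q'"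
  shows "Q = Q'"
proof -
  obtain k k' where k: "Q = dyadic_cube n k" "Q' = dyadic_cube n k'"
    using assms by (auto simp: dyadic_level_def)
  have "k i = k' i" for i using dyadic_cube_index assms(3,4) k by metis
  then show ?thesis using k by presburger
qed

lemma dyadic_level_coords_close:
  assumes "Q \<in> dyadic_level n" "x \<in> Q" "y \<in> Q"
  shows "\<bar>(x - y) $ i\<bar> \<le> 2 powr (- real n)"
proof -
  obtain k where "Q = dyadic_cube n k" using assms by (auto simp: dyadic_level_def)
  then have "of_int (k i) / 2 ^ n < x $ i" "x $ i \<le> of_int (k i) / 2 ^ n + 1 / 2 ^ n"
    "of_int (k i) / 2 ^ n < y $ i" "y $ i \<le> of_int (k i) / 2 ^ n + 1 / 2 ^ n"
    using assms by (auto simp: dyadic_cube_def add_divide_distrib)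
  then have "\<bar>(x - y) $ i\<bar> \<le> 1 / 2 ^ n" by (simp add: abs_le_iff)
  then show ?thesis by (simp add: powr_minus powr_realpow divide_inverse)
qed

lemma dyadic_level_nonempty_cube:
  assumes "Q \<in> dyadic_level n"
  shows "Q \<noteq> {}"
proof -
  obtain k where "Q = dyadic_cube n k" using assms by (auto simp: dyadic_level_def)
  then have "(\<chi> i. (of_int (k i) + 1) / 2 ^ n) \<in> Q"
    by (auto simp: dyadic_cube_def divide_strict_right_mono)
  then show ?thesis by blast
qed

lemma dyadic_level_borel:
  fixes Q :: "(real ^ 'd) set"
  shows "Q \<in> dyadic_level n \<Longrightarrow> Q \<in> sets borel"
  using measurable_dyadic_cube by (auto simp: dyadic_level_def)

text \<open>Cubes inside a cube of level \<open>n\<close> have level at least \<open>n\<close>, by comparison of volumes.\<close>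

lemma dyadic_sub_level:
  fixes Q :: "(real ^ 'd) set"
  assumes "Q \<in> dyadic_level n" "Q' \<in> dyadic_sub Q"
  obtains m where "n \<le> m" "Q' \<in> dyadic_level m"
proof -
  obtain m where m: "Q' \<in> dyadic_level m" and sub: "Q' \<subseteq> Q"
    using assms(2) by (auto simp: dyadic_sub_def dyadic_all_def)
  obtain k where k: "Q = dyadic_cube n k" using assms by (auto simp: dyadic_level_def)
  obtain k' where k': "Q' = dyadic_cube m k'" using m by (auto simp: dyadic_level_def)
  have "n \<le> m"
  proof (rule ccontr)
    assume "\<not> n \<le> m"
    then have "(1 / 2 ^ n :: real) < 1 / 2 ^ m" by (simp add: frac_less2)
    then have "(1 / 2 ^ n :: real) ^ CARD('d) < (1 / 2 ^ m) ^ CARD('d)"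
      by (intro power_strict_mono) auto
    moreover have "measure lborel Q' \<le> measure lborel Q"
    proof (rule measure_mono_fmeasurable[OF sub])
      show "Q' \<in> sets lborel" using dyadic_level_borel[OF m] by simp
      define a b :: "real ^ 'd" where "a = (\<chi> i. of_int (k i) / 2 ^ n)"
        and "b = (\<chi> i. (of_int (k i) + 1) / 2 ^ n)"
      have "Q \<subseteq> cbox a b" by (auto simp: k mem_box_cart a_def b_def dyadic_cube_def less_imp_le)
      then show "Q \<in> fmeasurable lborel"
        using dyadic_level_borel[OF assms(1)] by (intro fmeasurableI2[OF fmeasurable_cbox]) auto
    qed
    ultimately show False unfolding k k' measure_lborel_dyadic_cube by simp
  qed
  then show ?thesis using m that by blast
qed

text \<open>The indices of the level-\<open>n\<close> cubes that come within \<open>2 powr (- n)\<close> of a point lie in a box whose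
  side does not depend on \<open>n\<close>. This is what makes a codebook with \<open>n\<close> points see only \<open>O(n)\<close> cubes
  of each level.\<close>

lemma card_dyadic_near_bounded:
  fixes N :: "real ^ 'd \<Rightarrow> real"
  assumes "is_norm N"
  shows "\<exists>c :: nat. \<forall>n a. card {Q \<in> dyadic_level n. \<exists>x\<in>Q. N (x - a) < 2 powr (- real n)} \<le> c"
proof -
  obtain B where B: "0 < B" "\<And>x i. \<bar>x $ i\<bar> \<le> B * N x" using coords_le_is_norm[OF assms] by metis
  define b where "b = \<lceil>B\<rceil>"
  have "card {Q \<in> dyadic_level n. \<exists>x\<in>Q. N (x - a) < 2 powr (- real n)}
      \<le> nat (2 * b + 1) ^ CARD('d)" for n a
  proof -
    define I where "I i = {\<lceil>2 ^ n * a $ i\<rceil> - 1 - b..\<lceil>2 ^ n * a $ i\<rceil> - 1 + b}" for i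
    let ?K = "PiE UNIV I"
    have fin: "finite ?K" by (intro finite_PiE) (auto simp: I_def)
    have "{Q \<in> dyadic_level n. \<exists>x\<in>Q. N (x - a) < 2 powr (- real n)} \<subseteq> dyadic_cube n ` ?K"
    proof safe
      fix Q x assume Q: "Q \<in> dyadic_level n" "x \<in> Q" and near: "N (x - a) < 2 powr (- real n)"
      obtain k where k: "Q = dyadic_cube n k" using Q by (auto simp: dyadic_level_def)
      have "k i \<in> I i" for i
      proof -
        have "\<bar>x $ i - a $ i\<bar> \<le> B * 2 powr (- real n)"
          using B(2)[of "x - a" i] near B(1) by (smt (verit) mult_left_mono vector_minus_component)
        then have "2 ^ n * \<bar>x $ i - a $ i\<bar> \<le> 2 ^ n * (B * 2 powr (- real n))"
          by (intro mult_left_mono) auto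
        moreover have "\<bar>2 ^ n * x $ i - 2 ^ n * a $ i\<bar> = 2 ^ n * \<bar>x $ i - a $ i\<bar>"
          by (simp add: abs_mult right_diff_distrib[symmetric])
        ultimately have "\<bar>2 ^ n * x $ i - 2 ^ n * a $ i\<bar> \<le> B"
          by (simp add: powr_minus powr_realpow field_simps)
        then have "2 ^ n * x $ i \<le> 2 ^ n * a $ i + B" "2 ^ n * a $ i \<le> 2 ^ n * x $ i + B"
          by linarith+
        then have "\<lceil>2 ^ n * x $ i\<rceil> \<le> \<lceil>2 ^ n * a $ i\<rceil> + b" "\<lceil>2 ^ n * a $ i\<rceil> \<le> \<lceil>2 ^ n * x $ i\<rceil> + b"
          unfolding b_def using ceiling_mono ceiling_add_le order_trans by metis+
        then show ?thesis
          using dyadic_cube_index[of x n k i] Q k unfolding I_def atLeastAtMost_iff by auto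
      qed
      then show "Q \<in> dyadic_cube n ` ?K" using k by (auto simp: PiE_def Pi_def)
    qed
    then have "card {Q \<in> dyadic_level n. \<exists>x\<in>Q. N (x - a) < 2 powr (- real n)} \<le> card ?K"
      using fin surj_card_le by blast
    also have "\<dots> = (\<Prod>i\<in>(UNIV::'d set). nat (2 * b + 1))" by (simp add: card_PiE I_def algebra_simps)
    finally show ?thesis by simp
  qed
  then show ?thesis by blast
qed

section \<open>Decay of the partition function\<close>

locale unit_cube_measure = prob_space \<nu> for \<nu> :: "(real ^ 'd) measure" +
  assumes sets_borel: "sets \<nu> = sets borel"
    and support_unit_cube: "measure_support \<nu> \<subseteq> unit_cube"
begin

lemma dyadic_level_sets: "Q \<in> dyadic_level n \<Longrightarrow> Q \<in> sets \<nu>"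
  using dyadic_level_borel sets_borel by blast

lemma AE_unit_cube: "AE x in \<nu>. x \<in> unit_cube"
  using emeasure_compl_support[OF sets_borel] support_unit_cube by (intro AE_I') auto

lemma sum_dyadic_level: "(\<Sum>Q\<in>dyadic_level n. measure \<nu> Q) = 1"
proof -
  have "disjoint_family_on (\<lambda>Q. Q) (dyadic_level n :: (real ^ 'd) set set)"
    using dyadic_level_disjoint by (fastforce simp: disjoint_family_on_def)
  then have "(\<Sum>Q\<in>dyadic_level n. measure \<nu> Q) = measure \<nu> (\<Union>Q\<in>dyadic_level n. Q)"
    by (intro finite_measure_finite_Union[symmetric]) (auto simp: finite_dyadic_level dyadic_level_sets)
  also have "(\<Union>Q\<in>dyadic_level n. Q) = (unit_cube :: (real ^ 'd) set)" using Union_dyadic_level by auto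
  also have "measure \<nu> unit_cube = 1"
  proof -
    have "(unit_cube :: (real ^ 'd) set) \<in> sets \<nu>"
      unfolding Union_dyadic_level[of 0, symmetric]
      by (intro sets.finite_Union finite_dyadic_level) (use dyadic_level_sets in auto)
    then show ?thesis using AE_unit_cube by (simp add: prob_eq_1)
  qed
  finally show ?thesis .
qed

text \<open>The defining property of \<^const>\<open>dim_infty\<close>, with the logarithms removed; a cube of measure
  zero, whose logarithm is \<open>-\<infinity>\<close>, satisfies the bound trivially.\<close>

lemma measure_dyadic_level_decay:
  assumes "ereal \<delta> < dim_infty \<nu>"
  shows "eventually (\<lambda>n. \<forall>Q\<in>dyadic_level n. measure \<nu> Q \<le> 2 powr (- (\<delta> * real n))) sequentially"
proof -
  let ?M = "\<lambda>n. Max ((\<lambda>Q. elog (emeasure \<nu> Q)) ` dyadic_level n)"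
  have "eventually (\<lambda>n. ereal \<delta> < ?M n / ereal (ln (1 / 2 ^ n))) sequentially"
    using assms unfolding dim_infty_def by (rule less_LiminfD)
  then show ?thesis using eventually_gt_at_top[of 0]
  proof eventually_elim
    case (elim n)
    show ?case
    proof
      fix Q :: "(real ^ 'd) set" assume Q: "Q \<in> dyadic_level n"
      show "measure \<nu> Q \<le> 2 powr (- (\<delta> * real n))"
      proof (cases "measure \<nu> Q = 0")
        case False
        then have pos: "0 < measure \<nu> Q" by (simp add: zero_less_measure_iff)
        have fin: "finite ((\<lambda>Q. elog (emeasure \<nu> Q)) ` dyadic_level n)"
          by (simp add: finite_dyadic_level)
        have "elog (emeasure \<nu> R) \<le> 0" for R
          by (auto simp: elog_def emeasure_eq_measure ennreal_eq_0_iff not_le)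
        then have up: "?M n \<le> 0" using fin Q by (subst Max_le_iff) auto
        have "ereal (ln (measure \<nu> Q)) = elog (emeasure \<nu> Q)"
          using pos by (simp add: elog_ennreal emeasure_eq_measure)
        also have "\<dots> \<le> ?M n" using fin Q by (intro Max_ge) auto
        finally have lo: "ereal (ln (measure \<nu> Q)) \<le> ?M n" .
        obtain m where m: "?M n = ereal m" using lo up by (cases "?M n") auto
        have p: "0 < real n * ln 2" using elim(2) by simp
        have "\<delta> < m / (- (real n * ln 2))" using elim unfolding m by (simp add: ln_div ln_realpow)
        then have "\<delta> * (real n * ln 2) < - m" using p by (simp add: field_simps)
        then have "ln (measure \<nu> Q) \<le> - (\<delta> * real n) * ln 2" using lo m by (simp add: field_simps)
        then have "exp (ln (measure \<nu> Q)) \<le> exp (- (\<delta> * real n) * ln 2)" by (subst exp_le_cancel_iff)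
        then show ?thesis using pos by (simp add: powr_def)
      qed simp
    qed
  qed
qed

lemma J_max_ge:
  assumes "- dim_infty \<nu> < ereal r" "Q \<in> dyadic_level n"
  shows "measure \<nu> Q * 2 powr (- (real n * r)) \<le> J_max \<nu> r Q"
proof -
  have "Q \<in> dyadic_all" "Q \<in> dyadic_sub Q" using assms by (auto simp: dyadic_all_def dyadic_sub_def)
  then have "J_val \<nu> r Q \<le> J_max \<nu> r Q" using J_max_attained(2) prob_space_axioms assms(1) by blast
  then show ?thesis using J_val_level[OF assms(2)] by simp
qed

lemma J_max_nonneg:
  assumes "- dim_infty \<nu> < ereal r" "Q \<in> dyadic_level n"
  shows "0 \<le> J_max \<nu> r Q"
  using J_max_ge[OF assms] by (smt (verit) mult_nonneg_nonneg measure_nonneg powr_ge_zero)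

lemma J_max_witness:
  assumes "- dim_infty \<nu> < ereal r" "Q \<in> dyadic_level n"
  obtains m Q' where "n \<le> m" "Q' \<in> dyadic_level m" "Q' \<subseteq> Q"
    "J_max \<nu> r Q = measure \<nu> Q' * 2 powr (- (real m * r))"
proof -
  have "Q \<in> dyadic_all" using assms by (auto simp: dyadic_all_def)
  then obtain Q' where Q': "Q' \<in> dyadic_sub Q" "J_max \<nu> r Q = J_val \<nu> r Q'"
    using J_max_attained(1) prob_space_axioms assms(1) by blast
  obtain m where "n \<le> m" "Q' \<in> dyadic_level m" using dyadic_sub_level[OF assms(2) Q'(1)] .
  then show ?thesis using Q' J_val_level[of Q' m \<nu> r] by (intro that[of m Q']) (auto simp: dyadic_sub_def)
qed

text \<open>Lowering \<open>r\<close> raises the weight \<open>2 powr (- (m * r))\<close> of every cube, so it raises the maximum.\<close>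

lemma J_max_antimono:
  assumes "- dim_infty \<nu> < ereal r" "r \<le> r'" "Q \<in> dyadic_level n"
  shows "J_max \<nu> r' Q \<le> J_max \<nu> r Q"
proof -
  have r': "- dim_infty \<nu> < ereal r'" using assms by (meson ereal_less_eq(3) less_le_trans)
  obtain m Q' where Q': "Q' \<in> dyadic_level m" "Q' \<subseteq> Q"
    "J_max \<nu> r' Q = measure \<nu> Q' * 2 powr (- (real m * r'))"
    using J_max_witness[OF r' assms(3)] by metis
  have "J_max \<nu> r' Q \<le> measure \<nu> Q' * 2 powr (- (real m * r))"
    unfolding Q'(3) using assms(2) by (intro mult_left_mono powr_mono) (auto intro: mult_left_mono)
  also have "\<dots> = J_val \<nu> r Q'" using J_val_level[OF Q'(1)] by simp
  also have "\<dots> \<le> J_max \<nu> r Q"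
    using J_max_attained(2)[OF prob_space_axioms assms(1), of Q Q'] Q' assms(3)
    by (auto simp: dyadic_all_def dyadic_sub_def)
  finally show ?thesis .
qed

text \<open>For \<open>- r < \<delta> < dim_infty \<nu>\<close> the decay \<open>2 powr (- \<delta> * m)\<close> of the measures beats the growth
  \<open>2 powr (- r * m)\<close> of the weights, and the maximising subcube has level \<open>m \<ge> n\<close>.\<close>

lemma J_max_decay:
  assumes "- dim_infty \<nu> < ereal r"
  obtains c where "0 < c"
    "eventually (\<lambda>n. \<forall>Q\<in>dyadic_level n. J_max \<nu> r Q \<le> 2 powr (- (c * real n))) sequentially"
proof -
  have "ereal (- r) < dim_infty \<nu>" using assms by (cases "dim_infty \<nu>") auto
  then obtain \<delta> where \<delta>: "- r < \<delta>" "ereal \<delta> < dim_infty \<nu>"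
    using ereal_dense2 less_ereal.simps(1) by blast
  obtain n0 where n0: "\<And>n Q. n0 \<le> n \<Longrightarrow> Q \<in> dyadic_level n \<Longrightarrow> measure \<nu> Q \<le> 2 powr (- (\<delta> * real n))"
    using measure_dyadic_level_decay[OF \<delta>(2)] unfolding eventually_sequentially by blast
  have "J_max \<nu> r Q \<le> 2 powr (- ((\<delta> + r) * real n))" if n: "n0 \<le> n" "Q \<in> dyadic_level n" for n Q
  proof -
    obtain m Q' where Q': "n \<le> m" "Q' \<in> dyadic_level m"
      "J_max \<nu> r Q = measure \<nu> Q' * 2 powr (- (real m * r))"
      using J_max_witness[OF assms n(2)] by metis
    have "J_max \<nu> r Q \<le> 2 powr (- (\<delta> * real m)) * 2 powr (- (real m * r))"
      unfolding Q'(3) using n0[of m Q'] n Q' by (intro mult_right_mono) auto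
    also have "\<dots> = 2 powr (- ((\<delta> + r) * real m))" by (simp add: powr_add[symmetric] algebra_simps)
    also have "\<dots> \<le> 2 powr (- ((\<delta> + r) * real n))"
      using \<delta>(1) Q'(1) by (intro powr_mono) (auto intro: mult_left_mono)
    finally show ?thesis .
  qed
  then show ?thesis using that[of "\<delta> + r"] \<delta>(1) unfolding eventually_sequentially by auto
qed

text \<open>The sum in \<^const>\<open>tau_J\<close>, over all cubes: those with \<^const>\<open>J_max\<close> zero contribute nothing.
  This form is monotone in \<open>r\<close> termwise.\<close>

definition J_sum :: "real \<Rightarrow> real \<Rightarrow> nat \<Rightarrow> real" where
  "J_sum r p n = (\<Sum>Q\<in>dyadic_level n. J_max \<nu> r Q powr p)"

lemma J_sum_nonneg: "0 \<le> J_sum r p n"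
  by (simp add: J_sum_def sum_nonneg)

lemma tau_J_eq:
  assumes "- dim_infty \<nu> < ereal r"
  shows "tau_J \<nu> r p = Limsup sequentially (\<lambda>n. elog (ennreal (J_sum r p n)) / ereal (real n * ln 2))"
proof -
  have "(\<Sum>Q | Q \<in> dyadic_level n \<and> J_max \<nu> r Q > 0. J_max \<nu> r Q powr p) = J_sum r p n" for n
    unfolding J_sum_def using J_max_nonneg[OF assms, of _ n]
    by (intro sum.mono_neutral_left) (auto simp: finite_dyadic_level less_le)
  then show ?thesis unfolding tau_J_def by (simp add: ln_realpow)
qed

text \<open>A negative value of \<^const>\<open>tau_J\<close> means exponential decay of the sums \<open>J_sum r p n\<close> in \<open>n\<close>. This
  lemma and its converse below replace logarithms and upper limits by inequalities between reals.\<close>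

lemma tau_J_negD:
  assumes "- dim_infty \<nu> < ereal r" "tau_J \<nu> r p < 0"
  obtains \<eta> where "0 < \<eta>" "eventually (\<lambda>n. J_sum r p n \<le> 2 powr (- (\<eta> * real n))) sequentially"
proof -
  obtain y :: real where y: "tau_J \<nu> r p < ereal y" "y < 0"
    using ereal_dense2[OF assms(2)] by auto
  have "eventually (\<lambda>n. elog (ennreal (J_sum r p n)) / ereal (real n * ln 2) < ereal y) sequentially"
    using y(1) unfolding tau_J_eq[OF assms(1)] by (rule Limsup_lessD)
  then have "eventually (\<lambda>n. J_sum r p n \<le> 2 powr (- (- y * real n))) sequentially"
    using eventually_gt_at_top[of 0]
  proof eventually_elim
    case (elim n)
    show ?case
    proof (cases "J_sum r p n = 0")
      case False
      then have pos: "0 < J_sum r p n" using J_sum_nonneg[of r p n] by linarith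
      then have "ln (J_sum r p n) / (real n * ln 2) < y" using elim by (simp add: elog_ennreal)
      then have "ln (J_sum r p n) \<le> y * real n * ln 2" using elim(2) by (simp add: field_simps)
      then have "exp (ln (J_sum r p n)) \<le> exp (y * real n * ln 2)" by (subst exp_le_cancel_iff)
      then show ?thesis using pos by (simp add: powr_def)
    qed simp
  qed
  then show ?thesis using y(2) that[of "- y"] by simp
qed

lemma tau_J_negI:
  assumes "- dim_infty \<nu> < ereal r" "0 < \<eta>" "0 < K"
    and "eventually (\<lambda>n. J_sum r p n \<le> K * 2 powr (- (\<eta> * real n))) sequentially"
  shows "tau_J \<nu> r p < 0"
proof -
  have "eventually (\<lambda>n. elog (ennreal (J_sum r p n)) / ereal (real n * ln 2)
      \<le> ereal (- \<eta> + ln K / (real n * ln 2))) sequentially"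
    using assms(4) eventually_gt_at_top[of 0]
  proof eventually_elim
    case (elim n)
    have p: "0 < real n * ln 2" using elim(2) by simp
    have "elog (ennreal (J_sum r p n)) \<le> elog (ennreal (K * 2 powr (- (\<eta> * real n))))"
      using elim by (intro elog_mono ennreal_leI)
    also have "\<dots> = ereal (ln K - \<eta> * real n * ln 2)"
      using assms(3) by (simp add: elog_ennreal ln_mult ln_powr)
    finally have "elog (ennreal (J_sum r p n)) / ereal (real n * ln 2)
        \<le> ereal (ln K - \<eta> * real n * ln 2) / ereal (real n * ln 2)"
      using p by (intro ereal_divide_right_mono) auto
    also have "\<dots> = ereal (- \<eta> + ln K / (real n * ln 2))" using p elim(2) by (simp add: field_simps)
    finally show ?case .
  qed
  then have "tau_J \<nu> r p \<le> Limsup sequentially (\<lambda>n. ereal (- \<eta> + ln K / (real n * ln 2)))"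
    unfolding tau_J_eq[OF assms(1)] by (rule Limsup_mono)
  also have "\<dots> = ereal (- \<eta>)"
  proof (rule lim_imp_Limsup)
    have "(\<lambda>n. - \<eta> + (ln K / ln 2) * (1 / real n)) \<longlonglongrightarrow> - \<eta> + (ln K / ln 2) * 0"
      by (intro tendsto_intros lim_1_over_n)
    then show "(\<lambda>n. ereal (- \<eta> + ln K / (real n * ln 2))) \<longlonglongrightarrow> ereal (- \<eta>)"
      by (simp add: mult.commute)
  qed simp
  also have "\<dots> < 0" using assms(2) by simp
  finally show ?thesis .
qed

section \<open>The critical exponent\<close>

lemma q_crit_le:
  assumes "0 < p" "tau_J \<nu> r p < 0"
  shows "q_crit \<nu> r \<le> ereal p"
  unfolding q_crit_def using assms by (intro Inf_lower) auto

lemma q_crit_lessD: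
  assumes "q_crit \<nu> r < x"
  obtains p where "0 < p" "tau_J \<nu> r p < 0" "ereal p < x"
  using assms unfolding q_crit_def Inf_less_iff by auto

text \<open>There are at most \<open>2 ^ (n * d)\<close> cubes of level \<open>n\<close>, and each contributes at most
  \<open>2 powr (- c * p * n)\<close>; the sums decay as soon as \<open>c * p > d\<close>.\<close>

lemma q_crit_finite:
  assumes "- dim_infty \<nu> < ereal r"
  shows "q_crit \<nu> r < \<infinity>"
proof -
  obtain c where c: "0 < c"
    "eventually (\<lambda>n. \<forall>Q\<in>dyadic_level n. J_max \<nu> r Q \<le> 2 powr (- (c * real n))) sequentially"
    using J_max_decay[OF assms] .
  define p where "p = (real CARD('d) + 1) / c"
  have p: "0 < p" "c * p = real CARD('d) + 1" using c by (auto simp: p_def)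
  have "eventually (\<lambda>n. J_sum r p n \<le> 1 * 2 powr (- (1 * real n))) sequentially"
    using c(2)
  proof eventually_elim
    case (elim n)
    have "J_sum r p n \<le> (\<Sum>Q\<in>(dyadic_level n :: (real ^ 'd) set set). 2 powr (- (c * p * real n)))"
      unfolding J_sum_def
    proof (rule sum_mono)
      fix Q :: "(real ^ 'd) set" assume Q: "Q \<in> dyadic_level n"
      have "J_max \<nu> r Q powr p \<le> (2 powr (- (c * real n))) powr p"
        using elim Q J_max_nonneg[OF assms Q] p by (intro powr_mono2) auto
      then show "J_max \<nu> r Q powr p \<le> 2 powr (- (c * p * real n))" by (simp add: powr_powr algebra_simps)
    qed
    also have "\<dots> \<le> 2 ^ (n * CARD('d)) * 2 powr (- (c * p * real n))"
    proof -
      have "real (card (dyadic_level n :: (real ^ 'd) set set)) \<le> 2 ^ (n * CARD('d))"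
        using of_nat_mono[OF card_dyadic_level, where ?'a = real] by simp
      then show ?thesis by (simp add: mult_right_mono)
    qed
    also have "\<dots> = 2 powr (real (n * CARD('d))) * 2 powr (- (c * p * real n))"
      by (subst powr_realpow) auto
    also have "\<dots> = 2 powr (- real n)"
      unfolding p(2) powr_add[symmetric] by (simp add: algebra_simps)
    finally show ?case by simp
  qed
  then have "tau_J \<nu> r p < 0" using assms tau_J_negI[of r 1 1 p] by simp
  then have "q_crit \<nu> r \<le> ereal p" by (rule q_crit_le[OF p(1)])
  then show ?thesis by (cases "q_crit \<nu> r") auto
qed

text \<open>The total mass \<open>1\<close> is spread over at most \<open>2 ^ (n * d)\<close> cubes, so by convexity
  \<open>\<Sum> (measure \<nu> Q) powr p\<close> is at least of the order of \<open>2 powr (- n * d * (p - 1))\<close>, its value for the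
  uniform distribution. The weights add a factor \<open>2 powr (- n * r * p)\<close>, and the product has to decay.\<close>

lemma tau_J_neg_lower:
  assumes r: "- dim_infty \<nu> < ereal r" and "1 \<le> p" "tau_J \<nu> r p < 0"
  shows "- r * p < real CARD('d) * (p - 1)"
proof (rule ccontr)
  let ?d = "real CARD('d)"
  assume "\<not> ?thesis"
  then have ge: "?d * (p - 1) \<le> - r * p" by simp
  obtain \<eta> where \<eta>: "0 < \<eta>" "eventually (\<lambda>n. J_sum r p n \<le> 2 powr (- (\<eta> * real n))) sequentially"
    using tau_J_negD[OF r assms(3)] .
  define \<gamma> where "\<gamma> = (1/2 :: real) powr p"
  have g: "0 < \<gamma>" by (simp add: \<gamma>_def)
  have "\<gamma> \<le> J_sum r p n" for n
  proof -
    \<comment> \<open>Half the mean mass of a cube: the cubes below this threshold carry at most half of the mass.\<close>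
    define t where "t = (2 :: real) powr (- (real n * ?d)) / 2"
    have t: "0 < t" by (simp add: t_def)
    let ?S = "\<Sum>Q\<in>(dyadic_level n :: (real ^ 'd) set set). measure \<nu> Q powr p"
    have S0: "0 \<le> ?S" by (simp add: sum_nonneg)
    have "real (card (dyadic_level n :: (real ^ 'd) set set)) \<le> 2 ^ (n * CARD('d))"
      using of_nat_mono[OF card_dyadic_level, where ?'a = real] by simp
    also have "\<dots> = 2 powr (real n * ?d)" by (simp add: powr_realpow[symmetric])
    finally have "real (card (dyadic_level n :: (real ^ 'd) set set)) * t \<le> 2 powr (real n * ?d) * t"
      using t by (intro mult_right_mono) auto
    also have "\<dots> = 1 / 2" by (simp add: t_def powr_add[symmetric])
    finally have card: "real (card (dyadic_level n :: (real ^ 'd) set set)) * t \<le> 1 / 2" .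
    have "1 \<le> real (card (dyadic_level n :: (real ^ 'd) set set)) * t + t powr (1 - p) * ?S"
      using sum_le_threshold[of "dyadic_level n :: (real ^ 'd) set set" "measure \<nu>" t p] assms(2) t
      by (simp add: finite_dyadic_level sum_dyadic_level)
    with card have "1 / 2 \<le> t powr (1 - p) * ?S" by linarith
    then have "t powr (p - 1) * (1 / 2) \<le> t powr (p - 1) * (t powr (1 - p) * ?S)"
      by (intro mult_left_mono) auto
    also have "\<dots> = ?S" using t by (simp add: mult.assoc[symmetric] powr_add[symmetric])
    finally have low: "t powr (p - 1) / 2 \<le> ?S" by simp
    have "t powr (p - 1) / 2 = 2 powr (- (real n * ?d * (p - 1))) * \<gamma>"
    proof -
      have "t powr (p - 1) = 2 powr (- (real n * ?d * (p - 1))) * (1/2) powr (p - 1)"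
        unfolding t_def using powr_mult[of "2 powr (- (real n * ?d))" "1/2" "p - 1"]
        by (simp add: powr_powr algebra_simps)
      moreover have "(1/2 :: real) powr (p - 1) * (1/2) = \<gamma>"
        unfolding \<gamma>_def using powr_add[of "1/2 :: real" "p - 1" 1] by simp
      ultimately show ?thesis by simp
    qed
    with low have low: "2 powr (- (real n * ?d * (p - 1))) * \<gamma> \<le> ?S" by simp
    have "1 * \<gamma> \<le> 2 powr (real n * (- r * p - ?d * (p - 1))) * \<gamma>"
      using ge g by (intro mult_right_mono ge_one_powr_ge_zero) auto
    also have "\<dots> = 2 powr (- (real n * r * p)) * (2 powr (- (real n * ?d * (p - 1))) * \<gamma>)"
      unfolding mult.assoc[symmetric] powr_add[symmetric] by (simp add: algebra_simps)
    also have "\<dots> \<le> 2 powr (- (real n * r * p)) * ?S"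
      using low by (intro mult_left_mono) auto
    also have "\<dots> = (\<Sum>Q\<in>dyadic_level n. (measure \<nu> Q * 2 powr (- (real n * r))) powr p)"
      unfolding sum_distrib_left by (intro sum.cong refl) (simp add: powr_mult powr_powr algebra_simps)
    also have "\<dots> \<le> J_sum r p n"
      unfolding J_sum_def using J_max_ge[OF r] assms(2) by (intro sum_mono powr_mono2) auto
    finally show ?thesis by simp
  qed
  then have "eventually (\<lambda>n. \<gamma> \<le> 2 powr (- (\<eta> * real n))) sequentially"
    using \<eta>(2) by (auto elim!: eventually_mono intro: order_trans)
  moreover have "(\<lambda>n. 2 powr (- (\<eta> * real n))) \<longlonglongrightarrow> (0 :: real)" using \<eta>(1) by real_asymp
  then have "eventually (\<lambda>n. 2 powr (- (\<eta> * real n)) < \<gamma>) sequentially" using g by (rule order_tendstoD)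
  ultimately have "eventually (\<lambda>n :: nat. False) sequentially" by eventually_elim linarith
  then show False by simp
qed

text \<open>Since \<open>J_max \<nu> r Q \<le> 1\<close> for small cubes, an exponent \<open>p \<le> 1\<close> with decaying sums would make
  the sums for the exponent \<open>1\<close> decay too, although the latter are at least \<open>2 powr (- n * r)\<close>.\<close>

lemma tau_J_neg_imp_gt_1:
  assumes r: "- dim_infty \<nu> < ereal r" "r < 0" and "0 < p" "tau_J \<nu> r p < 0"
  shows "1 < p"
proof (rule ccontr)
  assume "\<not> 1 < p"
  obtain \<eta> where \<eta>: "0 < \<eta>" "eventually (\<lambda>n. J_sum r p n \<le> 2 powr (- (\<eta> * real n))) sequentially"
    using tau_J_negD[OF r(1) assms(4)] .
  obtain c where c: "0 < c"
    "eventually (\<lambda>n. \<forall>Q\<in>dyadic_level n. J_max \<nu> r Q \<le> 2 powr (- (c * real n))) sequentially"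
    using J_max_decay[OF r(1)] .
  from c(2) \<eta>(2) have "eventually (\<lambda>n. J_sum r 1 n \<le> 1 * 2 powr (- (\<eta> * real n))) sequentially"
  proof eventually_elim
    case (elim n)
    have "J_sum r 1 n \<le> J_sum r p n"
      unfolding J_sum_def
    proof (rule sum_mono)
      fix Q :: "(real ^ 'd) set" assume Q: "Q \<in> dyadic_level n"
      have "(2 :: real) powr (- (c * real n)) \<le> 2 powr 0" using c(1) by (intro powr_mono) auto
      then have "J_max \<nu> r Q \<le> 1" using elim(1) Q by fastforce
      then show "J_max \<nu> r Q powr 1 \<le> J_max \<nu> r Q powr p"
        using J_max_nonneg[OF r(1) Q] \<open>\<not> 1 < p\<close> by (intro powr_mono') auto
    qed
    then show ?case using elim(2) by simp
  qed
  then have "tau_J \<nu> r 1 < 0" using tau_J_negI[OF r(1) \<eta>(1), of 1 1] by simp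
  then show False using tau_J_neg_lower[OF r(1), of 1] r(2) by simp
qed

text \<open>By the lower bound above, every admissible exponent is at least \<open>d / (d + r)\<close>, which exceeds \<open>1\<close>.\<close>

lemma q_crit_gt_1:
  assumes r: "- dim_infty \<nu> < ereal r" "r < 0"
  shows "1 < q_crit \<nu> r"
proof -
  let ?d = "real CARD('d)"
  have d: "- r < ?d" using dim_infty_bounds(2)[OF prob_space_axioms sets_borel support_unit_cube] r(1)
    by (cases "dim_infty \<nu>") auto
  have lower: "ereal (?d / (?d + r)) \<le> q_crit \<nu> r"
    unfolding q_crit_def
  proof (rule Inf_greatest, clarify)
    fix p assume p: "0 < p" "tau_J \<nu> r p < 0"
    have "- r * p < ?d * (p - 1)"
      using tau_J_neg_lower[OF r(1) _ p(2)] tau_J_neg_imp_gt_1[OF r p] by simp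
    then show "ereal (?d / (?d + r)) \<le> ereal p" using d by (simp add: field_simps)
  qed
  have "1 < ereal (?d / (?d + r))" using d r(2) by (simp add: one_ereal_def field_simps)
  then show ?thesis using lower by (rule less_le_trans)
qed

lemma q_crit_antimono:
  assumes r: "- dim_infty \<nu> < ereal r" and "r \<le> r'"
  shows "q_crit \<nu> r' \<le> q_crit \<nu> r"
proof -
  have r': "- dim_infty \<nu> < ereal r'" using assms by (meson ereal_less_eq(3) less_le_trans)
  have "q_crit \<nu> r' \<le> ereal p" if p: "0 < p" "tau_J \<nu> r p < 0" for p
  proof -
    obtain \<eta> where \<eta>: "0 < \<eta>" "eventually (\<lambda>n. J_sum r p n \<le> 2 powr (- (\<eta> * real n))) sequentially"
      using tau_J_negD[OF r p(2)] .
    have "J_sum r' p n \<le> J_sum r p n" for n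
      unfolding J_sum_def using J_max_antimono[OF assms] J_max_nonneg[OF r'] p(1)
      by (intro sum_mono powr_mono2) auto
    then have "eventually (\<lambda>n. J_sum r' p n \<le> 1 * 2 powr (- (\<eta> * real n))) sequentially"
      using \<eta>(2) by (auto elim!: eventually_mono intro: order_trans)
    then show ?thesis using q_crit_le[OF p(1)] tau_J_negI[OF r' \<eta>(1), of 1 p] by simp
  qed
  then show ?thesis unfolding q_crit_def[of \<nu> r] by (intro Inf_greatest) auto
qed

end

section \<open>Energies of codebooks and the quantization error\<close>

text \<open>As \<open>r < 0\<close>, the quantization error is small exactly when some codebook has large energy.\<close>

definition energy :: "(real ^ 'd \<Rightarrow> real) \<Rightarrow> (real ^ 'd) measure \<Rightarrow> real \<Rightarrow> (real ^ 'd) set \<Rightarrow> ennreal" where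
  "energy N \<nu> r A = (\<integral>\<^sup>+x. neg_powr (ennreal (dist_set N x A)) r \<partial>\<nu>)"

lemma elog_quant_error_le:
  assumes "r < 0" "A \<in> codebooks n" "0 < K" "ennreal K \<le> energy N \<nu> r A"
  shows "elog (quant_error N \<nu> r n) \<le> ereal (ln K / r)"
proof -
  have "quant_error N \<nu> r n \<le> neg_powr (energy N \<nu> r A) (1 / r)"
    unfolding quant_error_def energy_def using assms(2) by (intro INF_lower)
  also have "\<dots> \<le> neg_powr (ennreal K) (1 / r)" using assms by (intro neg_powr_antimono) auto
  finally have "elog (quant_error N \<nu> r n) \<le> elog (ennreal (K powr (1 / r)))"
    using assms(3) by (simp add: neg_powr_ennreal elog_mono)
  then show ?thesis using assms(3) by (simp add: elog_ennreal ln_powr)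
qed

lemma elog_quant_error_ge:
  assumes "r < 0" "0 < K" "\<And>A. A \<in> codebooks n \<Longrightarrow> energy N \<nu> r A \<le> ennreal K"
  shows "ereal (ln K / r) \<le> elog (quant_error N \<nu> r n)"
proof -
  have "neg_powr (ennreal K) (1 / r) \<le> quant_error N \<nu> r n"
    unfolding quant_error_def energy_def[symmetric]
    using assms by (intro INF_greatest neg_powr_antimono) auto
  then have "elog (ennreal (K powr (1 / r))) \<le> elog (quant_error N \<nu> r n)"
    using assms(2) by (simp add: neg_powr_ennreal elog_mono)
  then show ?thesis using assms(2) by (simp add: elog_ennreal ln_powr)
qed

lemma codebooks_mono: "m \<le> n \<Longrightarrow> codebooks m \<subseteq> codebooks n"
  by (auto simp: codebooks_def)

context unit_cube_measure
begin

text \<open>Inside each \<open>Q \<in> T\<close> take the subcube \<open>P Q\<close>, of some level \<open>m Q\<close>, at which \<open>J_max \<nu> r Q\<close> is attained,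
  and put one point into it. On \<open>P Q\<close> the distance to the codebook is at most of the order of
  \<open>2 powr (- m Q)\<close>, so \<open>P Q\<close> alone contributes a multiple of \<open>J_max \<nu> r Q\<close> to the energy.
  The cubes of \<open>T\<close> are disjoint, and the contributions add up.\<close>

lemma energy_lower_bound:
  assumes N: "is_norm N" and r: "- dim_infty \<nu> < ereal r" "r < 0"
  obtains c where "0 < c"
    "\<And>n T j. T \<subseteq> dyadic_level n \<Longrightarrow> T \<noteq> {} \<Longrightarrow> 0 \<le> j \<Longrightarrow> (\<And>Q. Q \<in> T \<Longrightarrow> j \<le> J_max \<nu> r Q) \<Longrightarrow>
       \<exists>A\<in>codebooks (card T). ennreal (c * real (card T) * j) \<le> energy N \<nu> r A"
proof -
  obtain C where C: "0 < C" "\<And>x \<delta>. (\<And>i. \<bar>x $ i\<bar> \<le> \<delta>) \<Longrightarrow> N x \<le> C * \<delta>"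
    using is_norm_le_coords[OF N] by metis
  have "\<exists>A\<in>codebooks (card T). ennreal (C powr r * real (card T) * j) \<le> energy N \<nu> r A"
    if T: "T \<subseteq> dyadic_level n" "T \<noteq> {}" and j: "0 \<le> j" "\<And>Q. Q \<in> T \<Longrightarrow> j \<le> J_max \<nu> r Q" for n T j
  proof -
    have finT: "finite T" using T finite_dyadic_level finite_subset by blast
    have "\<exists>m P a. P \<in> dyadic_level m \<and> P \<subseteq> Q \<and> a \<in> P \<and>
        J_max \<nu> r Q = measure \<nu> P * 2 powr (- (real m * r))" if Q: "Q \<in> T" for Q
    proof -
      obtain m P where P: "P \<in> dyadic_level m" "P \<subseteq> Q" "J_max \<nu> r Q = measure \<nu> P * 2 powr (- (real m * r))"
        using J_max_witness[OF r(1)] Q T by (metis subsetD)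
      then show ?thesis using dyadic_level_nonempty_cube[OF P(1)] by blast
    qed
    then obtain m P a where P: "\<And>Q. Q \<in> T \<Longrightarrow> P Q \<in> dyadic_level (m Q)" "\<And>Q. Q \<in> T \<Longrightarrow> P Q \<subseteq> Q"
      "\<And>Q. Q \<in> T \<Longrightarrow> a Q \<in> P Q"
      "\<And>Q. Q \<in> T \<Longrightarrow> J_max \<nu> r Q = measure \<nu> (P Q) * 2 powr (- (real (m Q) * r))" by metis
    let ?w = "\<lambda>Q. C powr r * 2 powr (- (real (m Q) * r))"
    have w_meas: "(\<lambda>x. ennreal (?w Q) * indicator (P Q) x) \<in> borel_measurable \<nu>" if "Q \<in> T" for Q
    proof -
      have [measurable]: "P Q \<in> sets \<nu>" using P(1)[OF that] by (rule dyadic_level_sets)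
      show ?thesis by measurable
    qed
    have "a ` T \<in> codebooks (card T)"
      using finT T(2) card_gt_0_iff[of "a ` T"] by (auto simp: codebooks_def card_image_le Suc_le_eq)
    moreover have "ennreal (C powr r * real (card T) * j) \<le> energy N \<nu> r (a ` T)"
    proof -
      have "C powr r * real (card T) * j = (\<Sum>Q\<in>T. C powr r * j)" by simp
      also have "\<dots> \<le> (\<Sum>Q\<in>T. ?w Q * measure \<nu> (P Q))"
      proof (rule sum_mono)
        fix Q assume Q: "Q \<in> T"
        have "C powr r * j \<le> C powr r * J_max \<nu> r Q" using j(2)[OF Q] by (intro mult_left_mono) auto
        then show "C powr r * j \<le> ?w Q * measure \<nu> (P Q)" unfolding P(4)[OF Q] by (simp add: mult_ac)
      qed
      finally have "ennreal (C powr r * real (card T) * j) \<le> ennreal (\<Sum>Q\<in>T. ?w Q * measure \<nu> (P Q))"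
        by (rule ennreal_leI)
      also have "\<dots> = (\<Sum>Q\<in>T. ennreal (?w Q) * emeasure \<nu> (P Q))"
        by (subst sum_ennreal[symmetric]) (auto simp: emeasure_eq_measure ennreal_mult' intro!: sum.cong)
      also have "\<dots> = (\<Sum>Q\<in>T. \<integral>\<^sup>+x. ennreal (?w Q) * indicator (P Q) x \<partial>\<nu>)"
        using P(1) dyadic_level_sets by (intro sum.cong refl nn_integral_cmult_indicator[symmetric]) blast
      also have "\<dots> = (\<integral>\<^sup>+x. (\<Sum>Q\<in>T. ennreal (?w Q) * indicator (P Q) x) \<partial>\<nu>)"
        using w_meas by (rule nn_integral_sum[symmetric])
      also have "\<dots> \<le> energy N \<nu> r (a ` T)"
        unfolding energy_def
      proof (rule nn_integral_mono)
        fix x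
        show "(\<Sum>Q\<in>T. ennreal (?w Q) * indicator (P Q) x)
            \<le> neg_powr (ennreal (dist_set N x (a ` T))) r"
        proof (cases "\<exists>Q\<in>T. x \<in> P Q")
          case True
          then obtain Q where Q: "Q \<in> T" "x \<in> P Q" by blast
          have only_Q: "R = Q" if "R \<in> T" "x \<in> P R" for R
          proof (rule dyadic_level_disjoint[of R n Q x])
            show "R \<in> dyadic_level n" "Q \<in> dyadic_level n" using that(1) Q(1) T(1) by auto
            show "x \<in> R" "x \<in> Q" using P(2)[OF that(1)] that(2) P(2)[OF Q(1)] Q(2) by auto
          qed
          have "(\<Sum>R\<in>T. ennreal (?w R) * indicator (P R) x)
              = (\<Sum>R\<in>T. if R = Q then ennreal (?w Q) else 0)"
          proof (rule sum.cong[OF refl])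
            fix R assume "R \<in> T"
            show "ennreal (?w R) * indicator (P R) x = (if R = Q then ennreal (?w Q) else 0)"
            proof (cases "R = Q")
              case False
              then have "x \<notin> P R" using only_Q[OF \<open>R \<in> T\<close>] by blast
              then show ?thesis using False by simp
            qed (simp add: Q(2))
          qed
          also have "\<dots> = ennreal ((C * 2 powr (- real (m Q))) powr r)"
            using Q(1) finT C(1) by (simp add: powr_mult powr_powr)
          also have "\<dots> = neg_powr (ennreal (C * 2 powr (- real (m Q)))) r"
            using C(1) by (simp add: neg_powr_ennreal)
          also have "\<dots> \<le> neg_powr (ennreal (dist_set N x (a ` T))) r"
          proof (intro neg_powr_antimono r(2) ennreal_leI)
            have "dist_set N x (a ` T) \<le> N (x - a Q)"
              unfolding dist_set_def using Q(1) finT by (intro Min_le) auto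
            also have "\<dots> \<le> C * 2 powr (- real (m Q))"
              using dyadic_level_coords_close[OF P(1) Q(2) P(3)] Q(1) by (intro C(2)) auto
            finally show "dist_set N x (a ` T) \<le> C * 2 powr (- real (m Q))" .
          qed
          finally show ?thesis .
        next
          case False
          then have "(\<Sum>Q\<in>T. ennreal (?w Q) * indicator (P Q) x) = 0"
            by (intro sum.neutral) (auto simp: indicator_def)
          then show ?thesis by simp
        qed
      qed
      finally show ?thesis .
    qed
    ultimately show ?thesis by blast
  qed
  then show ?thesis using that[of "C powr r"] C(1) by simp
qed

text \<open>Growth of the energies gives regularity of the partition function. Applying the previous lemma to
  the \<open>m\<close> largest cubes of a level yields \<open>m * J \<le> const * m powr \<theta>\<close> for the \<open>m\<close>-th largest value \<open>J\<close>,
  so \<open>J\<close> is at most of the order of \<open>m powr (\<theta> - 1)\<close>, independently of the level. Hence the sums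
  \<open>J_sum r p n\<close> stay bounded for \<open>p > 1 / (1 - \<theta>)\<close>, and they decay for every larger exponent.\<close>

lemma q_crit_le_of_energy_growth:
  assumes N: "is_norm N" and r: "- dim_infty \<nu> < ereal r" "r < 0" and \<theta>: "0 < \<theta>" "\<theta> < 1"
    and growth: "eventually (\<lambda>n. \<forall>A\<in>codebooks n. energy N \<nu> r A \<le> ennreal (real n powr \<theta>)) sequentially"
  shows "q_crit \<nu> r \<le> ereal (1 / (1 - \<theta>))"
proof (rule ccontr)
  assume "\<not> ?thesis"
  then obtain p' where p': "1 / (1 - \<theta>) < p'" "ereal p' < q_crit \<nu> r"
    using ereal_dense2[of "ereal (1 / (1 - \<theta>))" "q_crit \<nu> r"] by (auto simp: not_le)
  then obtain p where p: "1 / (1 - \<theta>) < p" "p < p'" using dense by blast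
  have p0: "0 < p" using p(1) \<theta> by (smt (verit) divide_pos_pos)
  have exponent: "(\<theta> - 1) * p < - 1" using p(1) \<theta> by (simp add: field_simps)
  obtain c where c: "0 < c" "\<And>n T j. T \<subseteq> dyadic_level n \<Longrightarrow> T \<noteq> {} \<Longrightarrow> 0 \<le> j \<Longrightarrow>
       (\<And>Q. Q \<in> T \<Longrightarrow> j \<le> J_max \<nu> r Q) \<Longrightarrow>
       \<exists>A\<in>codebooks (card T). ennreal (c * real (card T) * j) \<le> energy N \<nu> r A"
    using energy_lower_bound[OF N r] by metis
  obtain n0 where n0: "1 \<le> n0" "\<And>n A. n0 \<le> n \<Longrightarrow> A \<in> codebooks n \<Longrightarrow> energy N \<nu> r A \<le> ennreal (real n powr \<theta>)"
    using growth unfolding eventually_sequentially by (metis le_trans nat_le_linear)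
  define K where "K = real n0 powr \<theta> / c"
  have K: "0 \<le> K" using c(1) by (simp add: K_def)
  define Z where "Z = (\<Sum>m. real m powr ((\<theta> - 1) * p))"
  have summ: "summable (\<lambda>m. real m powr ((\<theta> - 1) * p))"
    using exponent by (simp add: summable_real_powr_iff)
  have bounded: "J_sum r p n \<le> K powr p * Z" for n
  proof -
    have "\<exists>Q\<in>T. J_max \<nu> r Q \<le> K * real (card T) powr (\<theta> - 1)"
      if T: "T \<subseteq> dyadic_level n" "T \<noteq> {}" for T
    proof -
      have finT: "finite T" using T finite_dyadic_level finite_subset by blast
      define j where "j = Min (J_max \<nu> r ` T)"
      have "j \<in> J_max \<nu> r ` T" unfolding j_def using finT T(2) by (intro Min_in) auto
      then obtain Q where Q: "Q \<in> T" "J_max \<nu> r Q = j" by auto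
      have jle: "\<And>R. R \<in> T \<Longrightarrow> j \<le> J_max \<nu> r R" unfolding j_def using finT by simp
      have j0: "0 \<le> j" using Q J_max_nonneg[OF r(1)] T(1) by (metis subsetD)
      have card: "1 \<le> card T" using finT T(2) by (simp add: Suc_le_eq card_gt_0_iff)
      obtain A where A: "A \<in> codebooks (card T)" "ennreal (c * real (card T) * j) \<le> energy N \<nu> r A"
        using c(2)[OF T j0 jle] by blast
      \<comment> \<open>The growth bound starts at \<open>n0\<close>, so the codebook is regarded as one with \<open>n0 * card T\<close> points;
        this costs only the constant factor \<open>n0 powr \<theta>\<close>.\<close>
      have "card T \<le> n0 * card T" "n0 \<le> n0 * card T" using n0(1) card by auto
      then have "energy N \<nu> r A \<le> ennreal (real (n0 * card T) powr \<theta>)"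
        using n0(2)[of "n0 * card T" A] A(1) codebooks_mono by blast
      with A(2) have "ennreal (c * real (card T) * j) \<le> ennreal (real (n0 * card T) powr \<theta>)"
        by (rule order_trans)
      then have "c * real (card T) * j \<le> real (n0 * card T) powr \<theta>"
        by (subst (asm) ennreal_le_iff) auto
      then have "c * real (card T) * j \<le> real n0 powr \<theta> * real (card T) powr \<theta>"
        by (simp add: powr_mult)
      then have "j \<le> K * (real (card T) powr \<theta> / real (card T))"
        using c(1) card by (simp add: K_def field_simps)
      also have "real (card T) powr \<theta> / real (card T) = real (card T) powr (\<theta> - 1)"
        using card by (simp add: powr_diff)
      finally show ?thesis using Q by blast
    qed
    then have "J_sum r p n \<le> K powr p * (\<Sum>m\<in>{1..card (dyadic_level n :: (real ^ 'd) set set)}. real m powr ((\<theta> - 1) * p))"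
      unfolding J_sum_def using J_max_nonneg[OF r(1)] K p0
      by (intro sum_powr_le_of_ranked_bound finite_dyadic_level) auto
    also have "\<dots> \<le> K powr p * Z"
      unfolding Z_def by (intro mult_left_mono sum_le_suminf summ) auto
    finally show ?thesis .
  qed
  have KZ: "0 \<le> K powr p * Z" using bounded[of 0] J_sum_nonneg[of r p 0] by linarith
  obtain \<kappa> where \<kappa>: "0 < \<kappa>"
    "eventually (\<lambda>n. \<forall>Q\<in>dyadic_level n. J_max \<nu> r Q \<le> 2 powr (- (\<kappa> * real n))) sequentially"
    using J_max_decay[OF r(1)] .
  from \<kappa>(2) have "eventually (\<lambda>n. J_sum r p' n \<le> (K powr p * Z + 1) * 2 powr (- (\<kappa> * (p' - p) * real n))) sequentially"
  proof eventually_elim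
    case (elim n)
    have "J_max \<nu> r Q powr p' \<le> J_max \<nu> r Q powr p * 2 powr (- (\<kappa> * (p' - p) * real n))"
      if Q: "Q \<in> dyadic_level n" for Q
    proof -
      have "J_max \<nu> r Q powr p' = J_max \<nu> r Q powr p * J_max \<nu> r Q powr (p' - p)"
        by (simp add: powr_add[symmetric])
      also have "\<dots> \<le> J_max \<nu> r Q powr p * (2 powr (- (\<kappa> * real n))) powr (p' - p)"
        using elim Q p(2) J_max_nonneg[OF r(1) Q] by (intro mult_left_mono powr_mono2) auto
      finally show ?thesis by (simp add: powr_powr algebra_simps)
    qed
    then have "J_sum r p' n \<le> J_sum r p n * 2 powr (- (\<kappa> * (p' - p) * real n))"
      unfolding J_sum_def sum_distrib_right by (intro sum_mono) auto
    also have "\<dots> \<le> (K powr p * Z + 1) * 2 powr (- (\<kappa> * (p' - p) * real n))"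
      using bounded[of n] by (intro mult_right_mono) auto
    finally show ?case .
  qed
  then have "tau_J \<nu> r p' < 0"
    using KZ \<kappa>(1) p(2) by (intro tau_J_negI[OF r(1), of "\<kappa> * (p' - p)" "K powr p * Z + 1"]) auto
  then have "q_crit \<nu> r \<le> ereal p'" using p p0 by (intro q_crit_le) auto
  then show False using p'(2) by simp
qed

text \<open>The converse estimate. The integrand \<open>dist powr r\<close> is bounded by \<open>1\<close> plus the sum over \<open>k\<close> of the layers
  \<open>2 powr (- (k + 1) * r)\<close> on the set \<open>dist < 2 powr (- k)\<close>. That set is covered by a family \<open>F k\<close> of
  \<open>O(n)\<close> cubes of level \<open>k\<close>, so the layer integrates to at most a multiple of \<open>\<Sum>Q\<in>F k. J_max \<nu> r Q\<close>.
  By the threshold inequality and the decay of \<open>J_sum r p k\<close>, this is at most a multiple of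
  \<open>n powr (1 - 1 / p) * \<rho> ^ k\<close> for some \<open>\<rho> < 1\<close>, and the layers sum up geometrically.\<close>

lemma energy_upper_bound:
  assumes N: "is_norm N" and r: "- dim_infty \<nu> < ereal r" "r < 0" and p: "1 < p" "tau_J \<nu> r p < 0"
  obtains C where "0 < C"
    "\<And>n A. A \<in> codebooks n \<Longrightarrow> energy N \<nu> r A \<le> ennreal (C * real n powr (1 - 1 / p))"
proof -
  obtain \<eta> where \<eta>: "0 < \<eta>" "eventually (\<lambda>n. J_sum r p n \<le> 2 powr (- (\<eta> * real n))) sequentially"
    using tau_J_negD[OF r(1) p(2)] .
  obtain K where K: "0 < K" "\<And>k. J_sum r p k \<le> K * 2 powr (- (\<eta> * real k))"
  proof -
    obtain n0 where n0: "\<And>n. n0 \<le> n \<Longrightarrow> J_sum r p n \<le> 2 powr (- (\<eta> * real n))"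
      using \<eta>(2) unfolding eventually_sequentially by blast
    \<comment> \<open>The summands absorb the finitely many levels below \<open>n0\<close>.\<close>
    define K where "K = 1 + (\<Sum>k<n0. J_sum r p k * 2 powr (\<eta> * real k))"
    have nn: "0 \<le> J_sum r p k * 2 powr (\<eta> * real k)" for k by (simp add: J_sum_nonneg)
    have K1: "1 \<le> K" unfolding K_def using sum_nonneg[of "{..<n0}" "\<lambda>k. J_sum r p k * 2 powr (\<eta> * real k)"] nn by simp
    have "J_sum r p k \<le> K * 2 powr (- (\<eta> * real k))" for k
    proof (cases "n0 \<le> k")
      case True
      have "1 * 2 powr (- (\<eta> * real k)) \<le> K * 2 powr (- (\<eta> * real k))"
        using K1 by (intro mult_right_mono) auto
      then show ?thesis using n0[OF True] by linarith
    next
      case False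
      then have "J_sum r p k * 2 powr (\<eta> * real k) \<le> K"
        unfolding K_def using member_le_sum[of k "{..<n0}" "\<lambda>k. J_sum r p k * 2 powr (\<eta> * real k)"] nn
        by fastforce
      then show ?thesis by (simp add: powr_minus field_simps)
    qed
    then show ?thesis using that[of K] K1 by simp
  qed
  obtain c :: nat where c: "\<And>n a. card {Q \<in> dyadic_level n. \<exists>x\<in>Q. N (x - a) < 2 powr (- real n)} \<le> c"
    using card_dyadic_near_bounded[OF N] by blast
  define \<rho> where "\<rho> = (2::real) powr (- \<eta> / p)"
  have \<rho>: "0 < \<rho>" "\<rho> < 1"
    unfolding \<rho>_def using \<eta>(1) p(1) powr_less_mono[of "- \<eta> / p" 0 2] by auto
  have \<rho>k: "\<rho> ^ k = 2 powr (- \<eta> * real k / p)" for k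
    using \<rho>(1) by (simp add: \<rho>_def powr_realpow[symmetric] powr_powr)
  define M where "M = 2 powr (- r) * (real c + K)"
  have M0: "0 < M" using K(1) by (simp add: M_def add_nonneg_pos)
  define C where "C = 1 + M / (1 - \<rho>)"
  have "energy N \<nu> r A \<le> ennreal (C * real n powr (1 - 1 / p))" if A: "A \<in> codebooks n" for n A
  proof -
    have finA: "finite A" "A \<noteq> {}" "card A \<le> n" and n1: "1 \<le> n" using A by (auto simp: codebooks_def)
    define F where "F k = {Q \<in> dyadic_level k. \<exists>x\<in>Q. dist_set N x A < 2 powr (- real k)}" for k
    have finF: "finite (F k)" for k by (simp add: F_def finite_dyadic_level)
    have F_lev: "Q \<in> F k \<Longrightarrow> Q \<in> dyadic_level k" for Q k by (simp add: F_def)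
    have dist_attained: "\<exists>a\<in>A. dist_set N x A = N (x - a)" for x
    proof -
      have "dist_set N x A \<in> (\<lambda>y. N (x - y)) ` A"
        unfolding dist_set_def using finA by (intro Min_in) auto
      then show ?thesis by blast
    qed
    have cardF: "card (F k) \<le> n * c" for k
    proof -
      let ?G = "\<lambda>a. {Q \<in> dyadic_level k. \<exists>x\<in>Q. N (x - a) < 2 powr (- real k)}"
      have "F k \<subseteq> (\<Union>a\<in>A. ?G a)" 
      proof
        fix Q assume "Q \<in> F k"
        then obtain x where x: "Q \<in> dyadic_level k" "x \<in> Q" "dist_set N x A < 2 powr (- real k)"
          by (auto simp: F_def)
        moreover obtain a where "a \<in> A" "dist_set N x A = N (x - a)" using dist_attained by blast
        ultimately show "Q \<in> (\<Union>a\<in>A. ?G a)" by auto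
      qed
      then have "card (F k) \<le> card (\<Union>a\<in>A. ?G a)"
        by (intro card_mono) (auto simp: finA finite_dyadic_level)
      also have "\<dots> \<le> (\<Sum>a\<in>A. card (?G a))" by (intro card_UN_le finA)
      also have "\<dots> \<le> (\<Sum>a\<in>A. c)" by (intro sum_mono c)
      also have "\<dots> \<le> n * c" using finA by simp
      finally show ?thesis .
    qed
    define w where "w k = 2 powr (- ((real k + 1) * r))" for k
    have layer: "(\<Sum>Q\<in>F k. w k * measure \<nu> Q) \<le> M * real n powr (1 - 1 / p) * \<rho> ^ k" for k
    proof -
      \<comment> \<open>The threshold at which both parts of the sum have the order \<open>n powr (1 - 1 / p) * \<rho> ^ k\<close>.\<close>
      define t where "t = real n powr (- 1 / p) * \<rho> ^ k"
      have t: "0 < t" using n1 \<rho> by (simp add: t_def)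
      have t1: "real n * t = real n powr (1 - 1 / p) * \<rho> ^ k"
        using n1 powr_add[of "real n" 1 "- 1 / p"] by (simp add: t_def)
      have t2: "t powr (1 - p) * 2 powr (- (\<eta> * real k)) = real n powr (1 - 1 / p) * \<rho> ^ k"
      proof -
        have "t powr (1 - p) = real n powr (- 1 / p * (1 - p)) * 2 powr (- \<eta> * real k / p * (1 - p))"
          unfolding t_def \<rho>k using n1 by (simp add: powr_mult powr_powr)
        also have "- 1 / p * (1 - p) = 1 - 1 / p" using p(1) by (simp add: field_simps)
        finally have "t powr (1 - p) * 2 powr (- (\<eta> * real k))
            = real n powr (1 - 1 / p) * 2 powr (- \<eta> * real k / p * (1 - p) + - (\<eta> * real k))"
          by (simp only: powr_add mult.assoc)
        also have "- \<eta> * real k / p * (1 - p) + - (\<eta> * real k) = - \<eta> * real k / p"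
          using p(1) by (simp add: field_simps)
        finally show ?thesis by (simp add: \<rho>k)
      qed
      have "(\<Sum>Q\<in>F k. J_max \<nu> r Q) \<le> real (card (F k)) * t + t powr (1 - p) * (\<Sum>Q\<in>F k. J_max \<nu> r Q powr p)"
        using finF J_max_nonneg[OF r(1) F_lev] t p(1) by (intro sum_le_threshold) auto
      also have "\<dots> \<le> real (n * c) * t + t powr (1 - p) * (K * 2 powr (- (\<eta> * real k)))"
      proof (intro add_mono mult_right_mono mult_left_mono)
        have "(\<Sum>Q\<in>F k. J_max \<nu> r Q powr p) \<le> J_sum r p k"
          unfolding J_sum_def using F_lev by (intro sum_mono2 finite_dyadic_level) auto
        then show "(\<Sum>Q\<in>F k. J_max \<nu> r Q powr p) \<le> K * 2 powr (- (\<eta> * real k))"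
          using K(2)[of k] by linarith
        show "real (card (F k)) \<le> real (n * c)" using cardF by (rule of_nat_mono)
      qed (use t in auto)
      also have "\<dots> = real c * (real n * t) + K * (t powr (1 - p) * 2 powr (- (\<eta> * real k)))"
        by (simp add: algebra_simps)
      also have "\<dots> = (real c + K) * (real n powr (1 - 1 / p) * \<rho> ^ k)"
        unfolding t1 t2 by (simp add: algebra_simps)
      finally have J: "(\<Sum>Q\<in>F k. J_max \<nu> r Q) \<le> (real c + K) * (real n powr (1 - 1 / p) * \<rho> ^ k)" .
      have "(\<Sum>Q\<in>F k. w k * measure \<nu> Q) \<le> (\<Sum>Q\<in>F k. 2 powr (- r) * J_max \<nu> r Q)"
      proof (rule sum_mono)
        fix Q assume "Q \<in> F k"
        then have "2 powr (- r) * (measure \<nu> Q * 2 powr (- (real k * r))) \<le> 2 powr (- r) * J_max \<nu> r Q"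
          using J_max_ge[OF r(1) F_lev] by (intro mult_left_mono) auto
        moreover have "w k = 2 powr (- r) * 2 powr (- (real k * r))"
          by (simp add: w_def powr_add[symmetric] algebra_simps)
        ultimately show "w k * measure \<nu> Q \<le> 2 powr (- r) * J_max \<nu> r Q" by (simp add: mult_ac)
      qed
      also have "\<dots> \<le> 2 powr (- r) * ((real c + K) * (real n powr (1 - 1 / p) * \<rho> ^ k))"
        unfolding sum_distrib_left[symmetric] using J by (intro mult_left_mono) auto
      finally show ?thesis by (simp add: M_def mult_ac)
    qed
    define g where "g k x = (\<Sum>Q\<in>F k. ennreal (w k) * indicator Q x)" for k and x :: "real ^ 'd"
    have w_meas: "(\<lambda>x. ennreal (w k) * indicator Q x) \<in> borel_measurable \<nu>" if "Q \<in> F k" for Q k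
    proof -
      have [measurable]: "Q \<in> sets \<nu>" using F_lev[OF that] by (rule dyadic_level_sets)
      show ?thesis by measurable
    qed
    have g_meas: "g k \<in> borel_measurable \<nu>" for k
      unfolding g_def using w_meas by (rule borel_measurable_sum)
    have g_int: "(\<integral>\<^sup>+x. g k x \<partial>\<nu>) \<le> ennreal (M * real n powr (1 - 1 / p) * \<rho> ^ k)" for k
    proof -
      have "(\<integral>\<^sup>+x. g k x \<partial>\<nu>) = (\<Sum>Q\<in>F k. \<integral>\<^sup>+x. ennreal (w k) * indicator Q x \<partial>\<nu>)"
        unfolding g_def using w_meas by (rule nn_integral_sum)
      also have "\<dots> = (\<Sum>Q\<in>F k. ennreal (w k * measure \<nu> Q))"
      proof (intro sum.cong refl)
        fix Q assume "Q \<in> F k"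
        then have "Q \<in> sets \<nu>" using F_lev dyadic_level_sets by blast
        then show "(\<integral>\<^sup>+x. ennreal (w k) * indicator Q x \<partial>\<nu>) = ennreal (w k * measure \<nu> Q)"
          by (simp add: nn_integral_cmult_indicator emeasure_eq_measure ennreal_mult' w_def)
      qed
      also have "\<dots> = ennreal (\<Sum>Q\<in>F k. w k * measure \<nu> Q)" by (intro sum_ennreal) (simp add: w_def)
      finally show ?thesis using layer by (simp add: ennreal_leI)
    qed
    have pointwise: "neg_powr (ennreal (dist_set N x A)) r \<le> 1 + (\<Sum>k. g k x)" if x: "x \<in> unit_cube" for x
    proof -
      define \<delta> where "\<delta> = dist_set N x A"
      have \<delta>0: "0 \<le> \<delta>" using dist_attained[of x] N by (auto simp: \<delta>_def is_norm_def)
      have layer_ge: "ennreal (w k) \<le> g k x" if "\<delta> < 2 powr (- real k)" for k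
      proof -
        obtain Q where Q: "Q \<in> dyadic_level k" "x \<in> Q" using x Union_dyadic_level[of k] by blast
        then have "Q \<in> F k" using that by (auto simp: F_def \<delta>_def)
        then have "ennreal (w k) * indicator Q x \<le> g k x"
          unfolding g_def using finF member_le_sum[of Q "F k" "\<lambda>Q. ennreal (w k) * indicator Q x"] by simp
        then show ?thesis using Q(2) by simp
      qed
      consider "1 \<le> \<delta>" | "0 < \<delta>" "\<delta> < 1" | "\<delta> = 0" using \<delta>0 by linarith
      then show ?thesis
      proof cases
        case 1
        then have "\<delta> powr r \<le> 1" using r(2) powr_mono2'[of r 1 \<delta>] by simp
        then have "neg_powr (ennreal \<delta>) r \<le> 1" using 1 by (simp add: neg_powr_ennreal)
        then show ?thesis unfolding \<delta>_def by (simp add: add_increasing2)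
      next
        case 2
        \<comment> \<open>The dyadic layer of \<open>\<delta>\<close>: \<open>2 powr (- j) \<le> \<delta> < 2 powr (- (j - 1))\<close>.\<close>
        define j where "j = (LEAST j :: nat. 2 powr (- real j) \<le> \<delta>)"
        have "(\<lambda>j. 2 powr (- real j)) \<longlonglongrightarrow> (0 :: real)" by real_asymp
        then have "eventually (\<lambda>j. 2 powr (- real j) < \<delta>) sequentially" using 2(1) by (rule order_tendstoD)
        then have "\<exists>j. 2 powr (- real j) \<le> \<delta>" unfolding eventually_sequentially by (meson less_imp_le order_refl)
        then have j: "2 powr (- real j) \<le> \<delta>" unfolding j_def by (rule LeastI_ex)
        then have "j \<noteq> 0" using 2(2) by (intro notI) simp
        then obtain k where k: "j = Suc k" using not0_implies_Suc by blast
        have "\<delta> < 2 powr (- real k)" using not_less_Least[of k "\<lambda>j. 2 powr (- real j) \<le> \<delta>"] k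
          by (simp add: j_def not_le)
        have "\<delta> powr r \<le> (2 powr (- real j)) powr r" using j r(2) by (intro powr_mono2') auto
        also have "\<dots> = w k" by (simp add: w_def k powr_powr algebra_simps)
        finally have "neg_powr (ennreal \<delta>) r \<le> ennreal (w k)"
          using 2(1) by (simp add: neg_powr_ennreal ennreal_leI)
        also have "\<dots> \<le> g k x" by (rule layer_ge) fact
        also have "\<dots> \<le> (\<Sum>k. g k x)" using sum_le_suminf[of "\<lambda>k. g k x" "{k}"] by simp
        finally show ?thesis unfolding \<delta>_def by (simp add: add_increasing)
      next
        case 3
        \<comment> \<open>On the codebook itself the integrand is infinite, and so is the sum, as every layer is at least \<open>1\<close>.\<close>
        have ge_1: "1 \<le> g k x" for k
        proof -
          have "1 \<le> w k" unfolding w_def using r(2) by (intro ge_one_powr_ge_zero) (auto simp: mult_nonneg_nonpos)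
          then have "1 \<le> ennreal (w k)" by simp
          also have "\<dots> \<le> g k x" using 3 by (intro layer_ge) simp
          finally show ?thesis .
        qed
        have "of_nat m \<le> (\<Sum>k. g k x)" for m
        proof -
          have "(\<Sum>k<m. 1) \<le> (\<Sum>k<m. g k x)" by (intro sum_mono ge_1)
          also have "\<dots> \<le> (\<Sum>k. g k x)" by (intro sum_le_suminf) auto
          finally show ?thesis by simp
        qed
        then have "(\<Sum>k. g k x) = \<infinity>" by (metis ennreal_Ex_less_of_nat infinity_ennreal_def linorder_not_less top.not_eq_extremum)
        then show ?thesis by simp
      qed
    qed
    have geom: "(\<Sum>k. ennreal (M * real n powr (1 - 1 / p) * \<rho> ^ k))
        = ennreal (M * real n powr (1 - 1 / p) * (1 / (1 - \<rho>)))"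
      using \<rho> M0 by (intro suminf_ennreal_eq sums_mult geometric_sums) auto
    have "energy N \<nu> r A \<le> (\<integral>\<^sup>+x. 1 + (\<Sum>k. g k x) \<partial>\<nu>)"
      unfolding energy_def using AE_unit_cube pointwise by (intro nn_integral_mono_AE) auto
    also have "\<dots> = 1 + (\<Sum>k. \<integral>\<^sup>+x. g k x \<partial>\<nu>)"
      using g_meas by (subst nn_integral_add) (auto simp: nn_integral_suminf emeasure_space_1)
    also have "\<dots> \<le> 1 + (\<Sum>k. ennreal (M * real n powr (1 - 1 / p) * \<rho> ^ k))"
      by (intro add_left_mono suminf_le g_int) auto
    also have "\<dots> = ennreal (1 + M * real n powr (1 - 1 / p) * (1 / (1 - \<rho>)))"
      unfolding geom using M0 \<rho> by (subst ennreal_plus) auto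
    also have "\<dots> \<le> ennreal (C * real n powr (1 - 1 / p))"
    proof (rule ennreal_leI)
      have "1 \<le> real n powr (1 - 1 / p)" using n1 p(1) by (intro ge_one_powr_ge_zero) auto
      then show "1 + M * real n powr (1 - 1 / p) * (1 / (1 - \<rho>)) \<le> C * real n powr (1 - 1 / p)"
        by (simp add: C_def algebra_simps)
    qed
    finally show ?thesis .
  qed
  moreover have "0 < C" using M0 \<rho> by (simp add: C_def add_pos_pos)
  ultimately show ?thesis using that by blast
qed

section \<open>The lower quantization dimension\<close>

text \<open>If the dimension exceeded the bound, the energies would grow no faster than \<open>n powr \<theta>\<close> with
  \<open>\<theta> < 1 - 1 / q\<close>, and then \<open>q_crit \<nu> r \<le> 1 / (1 - \<theta>) < q\<close>.\<close>

lemma lower_quant_dim_le: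
  assumes N: "is_norm N" and r: "- dim_infty \<nu> < ereal r" "r < 0" and q: "q_crit \<nu> r = ereal q" "1 < q"
  shows "lower_quant_dim N \<nu> r \<le> ereal (- r * (q / (q - 1)))"
proof (rule ccontr)
  assume "\<not> ?thesis"
  then obtain y where y: "- r * (q / (q - 1)) < y" "ereal y < lower_quant_dim N \<nu> r"
    using ereal_dense2[of "ereal (- r * (q / (q - 1)))"] by (auto simp: not_le)
  have "0 < - r * (q / (q - 1))" using r q by (intro mult_pos_pos) auto
  then have y0: "0 < y" using y(1) by linarith
  define \<theta> where "\<theta> = - r / y"
  have "- r * q < y * (q - 1)" using y(1) q(2) by (simp add: field_simps)
  then have \<theta>q: "\<theta> * q < q - 1" using y0 by (simp add: \<theta>_def field_simps)
  have \<theta>0: "0 < \<theta>" using r(2) y0 unfolding \<theta>_def by (intro divide_pos_pos) auto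
  have \<theta>1: "\<theta> < 1"
  proof (rule ccontr)
    assume "\<not> \<theta> < 1"
    then have "q \<le> \<theta> * q" using q(2) by simp
    then show False using \<theta>q by linarith
  qed
  have "eventually (\<lambda>n. ereal y < ereal (ln (real n)) / - elog (quant_error N \<nu> r n)) sequentially"
    using y(2) unfolding lower_quant_dim_def by (rule less_LiminfD)
  then have "eventually (\<lambda>n. \<forall>A\<in>codebooks n. energy N \<nu> r A \<le> ennreal (real n powr \<theta>)) sequentially"
    using eventually_ge_at_top[of 2]
  proof eventually_elim
    case (elim n)
    have ln: "0 < ln (real n)" using elim(2) by simp
    show ?case
    proof (rule ccontr)
      assume "\<not> ?case"
      then obtain A where A: "A \<in> codebooks n" "ennreal (real n powr \<theta>) \<le> energy N \<nu> r A"
        by (auto simp: not_le less_imp_le)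
      have "elog (quant_error N \<nu> r n) \<le> ereal (ln (real n powr \<theta>) / r)"
        using A elim(2) by (intro elog_quant_error_le[OF r(2)]) auto
      also have "ln (real n powr \<theta>) / r = - (ln (real n) / y)"
        using elim(2) r(2) by (simp add: ln_powr \<theta>_def)
      finally have "- ereal (- (ln (real n) / y)) \<le> - elog (quant_error N \<nu> r n)"
        by (simp only: ereal_minus_le_minus)
      then have "ereal (ln (real n) / y) \<le> - elog (quant_error N \<nu> r n)" by simp
      moreover have "0 < ln (real n) / y" using ln y0 by simp
      ultimately obtain v where v: "- elog (quant_error N \<nu> r n) = ereal v" "ln (real n) / y \<le> v"
        using elim(1) y0 by (cases "- elog (quant_error N \<nu> r n)") auto
      then have "0 < v" using \<open>0 < ln (real n) / y\<close> by linarith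
      then have "y < ln (real n) / v" using elim(1) v(1) by simp
      then show False using v(2) \<open>0 < v\<close> y0 by (simp add: field_simps)
    qed
  qed
  then have "q_crit \<nu> r \<le> ereal (1 / (1 - \<theta>))" by (rule q_crit_le_of_energy_growth[OF N r \<theta>0 \<theta>1])
  then have "q * (1 - \<theta>) \<le> 1" using q(1) \<theta>1 by (simp add: field_simps)
  then show False using \<theta>q by (simp add: algebra_simps)
qed

text \<open>Ensures that the denominator in \<^const>\<open>lower_quant_dim\<close> is eventually nonnegative. If all energies
  were below \<open>1\<close>, they would grow no faster than \<open>n powr \<theta>\<close> for every \<open>\<theta> > 0\<close>, and \<open>q_crit \<nu> r\<close> could
  not exceed \<open>1\<close>.\<close>

lemma energy_eventually_ge_1:
  assumes N: "is_norm N" and r: "- dim_infty \<nu> < ereal r" "r < 0"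
  shows "eventually (\<lambda>n. \<exists>A\<in>codebooks n. 1 \<le> energy N \<nu> r A) sequentially"
proof -
  obtain q where q: "q_crit \<nu> r = ereal q" "1 < q"
    using q_crit_gt_1[OF r] q_crit_finite[OF r(1)] by (cases "q_crit \<nu> r") auto
  \<comment> \<open>Any exponent in \<open>(0, 1 - 1 / q)\<close> will do.\<close>
  define \<theta> where "\<theta> = (q - 1) / (2 * q)"
  have \<theta>: "0 < \<theta>" "\<theta> < 1" using q(2) by (auto simp: \<theta>_def field_simps)
  have "\<exists>n. \<exists>A\<in>codebooks n. 1 \<le> energy N \<nu> r A"
  proof (rule ccontr)
    assume neg: "\<not> ?thesis"
    have "eventually (\<lambda>n. \<forall>A\<in>codebooks n. energy N \<nu> r A \<le> ennreal (real n powr \<theta>)) sequentially"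
    proof (rule eventually_sequentiallyI[of 1], rule ballI)
      fix n :: nat and A :: "(real ^ 'd) set" assume n: "1 \<le> n" and A: "A \<in> codebooks n"
      have "energy N \<nu> r A \<le> 1" using neg A by (meson linear)
      also have "1 \<le> ennreal (real n powr \<theta>)" using n \<theta> by (simp add: ge_one_powr_ge_zero)
      finally show "energy N \<nu> r A \<le> ennreal (real n powr \<theta>)" .
    qed
    then have "q_crit \<nu> r \<le> ereal (1 / (1 - \<theta>))" by (rule q_crit_le_of_energy_growth[OF N r \<theta>])
    then have "q * (1 - \<theta>) \<le> 1" using q(1) \<theta> by (simp add: field_simps)
    then have "q - (q - 1) / 2 \<le> 1" using q(2) by (simp add: \<theta>_def field_simps)
    then show False using q(2) by argo
  qed
  then obtain n A where "A \<in> codebooks n" "1 \<le> energy N \<nu> r A" by blast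
  then show ?thesis using codebooks_mono by (intro eventually_sequentiallyI[of n]) blast
qed

lemma lower_quant_dim_ge_of_tau_J_neg:
  assumes N: "is_norm N" and r: "- dim_infty \<nu> < ereal r" "r < 0" and p: "1 < p" "tau_J \<nu> r p < 0"
  shows "ereal (- r * (p / (p - 1))) \<le> lower_quant_dim N \<nu> r"
proof -
  obtain C where C: "0 < C"
    "\<And>n A. A \<in> codebooks n \<Longrightarrow> energy N \<nu> r A \<le> ennreal (C * real n powr (1 - 1 / p))"
    using energy_upper_bound[OF N r p] by metis
  define \<theta> s where "\<theta> = 1 - 1 / p" and "s = - r"
  have \<theta>: "0 < \<theta>" and s: "0 < s" using p r by (auto simp: \<theta>_def s_def)
  define b where "b n = (ln C + \<theta> * ln (real n)) / s" for n
  have "filterlim b at_top sequentially" unfolding b_def using \<theta> s by real_asymp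
  then have b_pos: "eventually (\<lambda>n. 0 < b n) sequentially" by (simp add: filterlim_at_top_dense)
  have "eventually (\<lambda>n. ereal (ln (real n) / b n) \<le> ereal (ln (real n)) / - elog (quant_error N \<nu> r n)) sequentially"
    using energy_eventually_ge_1[OF N r] eventually_ge_at_top[of 2] b_pos
  proof eventually_elim
    case (elim n)
    obtain A where A: "A \<in> codebooks n" "1 \<le> energy N \<nu> r A" using elim(1) by blast
    have "elog (quant_error N \<nu> r n) \<le> ereal (ln 1 / r)"
      using A by (intro elog_quant_error_le[OF r(2)]) auto
    then have lo: "0 \<le> - elog (quant_error N \<nu> r n)" by (simp add: zero_ereal_def[symmetric])
    have "ereal (ln (C * real n powr \<theta>) / r) \<le> elog (quant_error N \<nu> r n)"
      using C elim(2) unfolding \<theta>_def by (intro elog_quant_error_ge[OF r(2)]) auto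
    also have "ln (C * real n powr \<theta>) / r = - b n"
      using C(1) elim(2) r(2) by (simp add: ln_mult ln_powr b_def s_def)
    finally have up: "- elog (quant_error N \<nu> r n) \<le> ereal (b n)"
      by (simp add: ereal_uminus_le_reorder)
    obtain v where v: "- elog (quant_error N \<nu> r n) = ereal v" "0 \<le> v" "v \<le> b n"
      using lo up by (cases "- elog (quant_error N \<nu> r n)") auto
    show ?case
    proof (cases "v = 0")
      case True
      then show ?thesis using v(1) elim(2) by (simp add: divide_ereal_def)
    next
      case False
      then show ?thesis using v elim by (auto intro!: divide_left_mono)
    qed
  qed
  then have "Liminf sequentially (\<lambda>n. ereal (ln (real n) / b n)) \<le> lower_quant_dim N \<nu> r"
    unfolding lower_quant_dim_def by (rule Liminf_mono)
  moreover have "Liminf sequentially (\<lambda>n. ereal (ln (real n) / b n)) = ereal (s / \<theta>)"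
  proof (rule lim_imp_Liminf)
    have "(\<lambda>n. ln (real n) / b n) \<longlonglongrightarrow> s / \<theta>"
    proof -
      have "(\<lambda>n. ln (real n) / b n) \<longlonglongrightarrow> inverse \<theta> * s"
        unfolding b_def using \<theta> s by real_asymp
      then show ?thesis by (simp add: field_simps)
    qed
    then show "(\<lambda>n. ereal (ln (real n) / b n)) \<longlonglongrightarrow> ereal (s / \<theta>)" by simp
  qed simp
  moreover have "s / \<theta> = - r * (p / (p - 1))" using p(1) by (simp add: s_def \<theta>_def field_simps)
  ultimately show ?thesis by simp
qed

text \<open>The exponents with \<open>tau_J \<nu> r p < 0\<close> come arbitrarily close to \<open>q\<close> from above, and
  \<open>p / (p - 1)\<close> is decreasing and continuous in \<open>p\<close>.\<close>

lemma lower_quant_dim_ge: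
  assumes N: "is_norm N" and r: "- dim_infty \<nu> < ereal r" "r < 0" and q: "q_crit \<nu> r = ereal q" "1 < q"
  shows "ereal (- r * (q / (q - 1))) \<le> lower_quant_dim N \<nu> r"
proof (rule tendsto_upperbound)
  show "((\<lambda>x. ereal (- r * (x / (x - 1)))) \<longlongrightarrow> ereal (- r * (q / (q - 1)))) (at_right q)"
    using q(2) by (intro tendsto_intros) auto
  show "eventually (\<lambda>x. ereal (- r * (x / (x - 1))) \<le> lower_quant_dim N \<nu> r) (at_right q)"
    using eventually_at_right_less[of q]
  proof eventually_elim
    case (elim x)
    then have "q_crit \<nu> r < ereal x" using q(1) by simp
    then obtain p where p: "0 < p" "tau_J \<nu> r p < 0" "ereal p < ereal x" using q_crit_lessD by blast
    have p1: "1 < p" using tau_J_neg_imp_gt_1[OF r p(1,2)] .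
    have "x / (x - 1) \<le> p / (p - 1)" using p(3) p1 by (simp add: field_simps)
    then have "- r * (x / (x - 1)) \<le> - r * (p / (p - 1))" using r(2) by (intro mult_left_mono) auto
    then have "ereal (- r * (x / (x - 1))) \<le> ereal (- r * (p / (p - 1)))" by simp
    also have "\<dots> \<le> lower_quant_dim N \<nu> r" by (rule lower_quant_dim_ge_of_tau_J_neg[OF N r p1 p(2)])
    finally show ?case .
  qed
qed simp

end

text \<open>The convention \<open>a_ratio \<infinity> = 1\<close> is the continuous extension of \<open>a / (a - 1)\<close>.\<close>

lemma tendsto_a_ratio:
  fixes Q :: "'a \<Rightarrow> real"
  assumes "((\<lambda>x. ereal (Q x)) \<longlongrightarrow> a) F" and "1 < a"
  shows "((\<lambda>x. ereal (Q x / (Q x - 1))) \<longlongrightarrow> a_ratio a) F"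
proof (cases "a = \<infinity>")
  case True
  then have "filterlim Q at_top F" using assms(1) by (simp add: tendsto_PInfty_eq_at_top)
  moreover have "((\<lambda>x :: real. x / (x - 1)) \<longlongrightarrow> 1) at_top" by real_asymp
  ultimately have "((\<lambda>x. Q x / (Q x - 1)) \<longlongrightarrow> 1) F" by (rule filterlim_compose[rotated])
  then show ?thesis using True by (simp add: a_ratio_def one_ereal_def)
next
  case False
  then obtain b where b: "a = ereal b" "1 < b" using assms(2) by (cases a) auto
  then have "(Q \<longlongrightarrow> b) F" using assms(1) by simp
  then have "((\<lambda>x. Q x / (Q x - 1)) \<longlongrightarrow> b / (b - 1)) F" using b(2) by (intro tendsto_intros) auto
  then show ?thesis using b by (simp add: a_ratio_def one_ereal_def)
qed

lemma one_le_a_ratio: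
  assumes "1 < a"
  shows "1 \<le> a_ratio a"
  using assms by (cases a) (auto simp: a_ratio_def one_ereal_def field_simps)

text \<open>On \<open>(- dim_infty \<nu>, 0)\<close> the dimension equals \<open>- r * a_ratio (q_crit \<nu> r)\<close>. As \<^const>\<open>q_crit\<close> is
  decreasing in \<open>r\<close>, it tends to its supremum \<open>a_crit \<nu>\<close> at the left end point.\<close>

theorem lemma1p8:
  fixes N :: "real ^ 'd \<Rightarrow> real" and \<nu> :: "(real ^ 'd) measure"
  assumes "is_norm N"
    and "prob_space \<nu>" and "sets \<nu> = sets borel"
    and "compact (measure_support \<nu>)" and "measure_support \<nu> \<subseteq> unit_cube"
    and "0 < dim_infty \<nu>"
  shows "\<exists>L. ((\<lambda>r. lower_quant_dim N \<nu> r) \<longlongrightarrow> L) (at_right (- real_of_ereal (dim_infty \<nu>)))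
             \<and> dim_infty \<nu> \<le> L
             \<and> L = a_ratio (a_crit \<nu>) * dim_infty \<nu>"
proof -
  interpret unit_cube_measure \<nu>
    using assms by (simp add: unit_cube_measure_def unit_cube_measure_axioms_def)
  obtain D where D: "dim_infty \<nu> = ereal D" "0 < D"
    using dim_infty_bounds(2)[OF assms(2,3,5)] assms(6) by (cases "dim_infty \<nu>") auto
  have range: "- dim_infty \<nu> < ereal r \<longleftrightarrow> - D < r" for r using D by simp
  define Q where "Q r = real_of_ereal (q_crit \<nu> r)" for r
  have Q: "q_crit \<nu> r = ereal (Q r)" "1 < Q r" if "- D < r" "r < 0" for r
  proof -
    have r: "- dim_infty \<nu> < ereal r" using that(1) range by blast
    from q_crit_gt_1[OF r that(2)] q_crit_finite[OF r] show "q_crit \<nu> r = ereal (Q r)" "1 < Q r"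
      by (cases "q_crit \<nu> r"; simp add: Q_def)+
  qed
  have near: "eventually (\<lambda>r. - D < r \<and> r < 0) (at_right (- D))"
    using D(2) by (intro eventually_conj eventually_at_right_less order_tendstoD(2)[OF tendsto_ident_at]) auto
  have Sup_a: "a_crit \<nu> = Sup {ereal (Q r) | r. - D < r \<and> r < 0}"
  proof -
    have "{q_crit \<nu> r | r. - D < r \<and> r < 0} = {ereal (Q r) | r. - D < r \<and> r < 0}"
      using Q(1) by (intro Collect_cong ex_cong1) auto
    then show ?thesis unfolding a_crit_def range by simp
  qed
  have Q_le_a: "ereal (Q r) \<le> a_crit \<nu>" if "- D < r" "r < 0" for r
    unfolding Sup_a using that by (intro Sup_upper) auto
  have a1: "1 < a_crit \<nu>"
  proof -
    have "1 < ereal (Q (- D / 2))" using Q(2)[of "- D / 2"] D(2) by (simp add: one_ereal_def)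
    also have "\<dots> \<le> a_crit \<nu>" using D(2) by (intro Q_le_a) auto
    finally show ?thesis .
  qed
  have lim_Q: "((\<lambda>r. ereal (Q r)) \<longlongrightarrow> a_crit \<nu>) (at_right (- D))"
  proof (rule order_tendstoI)
    fix l assume "l < a_crit \<nu>"
    then obtain r0 where r0: "- D < r0" "r0 < 0" "l < ereal (Q r0)"
      unfolding Sup_a less_Sup_iff by auto
    have "eventually (\<lambda>r. r < r0) (at_right (- D))"
      using r0(1) by (intro order_tendstoD(2)[OF tendsto_ident_at])
    with near show "eventually (\<lambda>r. l < ereal (Q r)) (at_right (- D))"
    proof eventually_elim
      case (elim r)
      then have "q_crit \<nu> r0 \<le> q_crit \<nu> r" by (intro q_crit_antimono) (auto simp: range)
      then show ?case using r0 Q(1) elim by (auto intro: less_le_trans)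
    qed
  next
    fix l assume "a_crit \<nu> < l"
    with near show "eventually (\<lambda>r. ereal (Q r) < l) (at_right (- D))"
      by (auto elim!: eventually_mono intro: le_less_trans[OF Q_le_a])
  qed
  have "((\<lambda>r. ereal (Q r / (Q r - 1)) * ereal (- r)) \<longlongrightarrow> a_ratio (a_crit \<nu>) * ereal D) (at_right (- D))"
  proof (rule tendsto_mult_ereal_pos)
    show "((\<lambda>r. ereal (Q r / (Q r - 1))) \<longlongrightarrow> a_ratio (a_crit \<nu>)) (at_right (- D))"
      using lim_Q a1 by (rule tendsto_a_ratio)
    have "((\<lambda>r. - r) \<longlongrightarrow> - (- D)) (at_right (- D))" by (intro tendsto_intros)
    then show "((\<lambda>r. ereal (- r)) \<longlongrightarrow> ereal D) (at_right (- D))" by simp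
    show "0 < a_ratio (a_crit \<nu>)" using one_le_a_ratio[OF a1] by (rule less_le_trans[rotated]) simp
    show "0 < ereal D" using D(2) by simp
  qed
  moreover have "eventually (\<lambda>r. ereal (Q r / (Q r - 1)) * ereal (- r) = lower_quant_dim N \<nu> r) (at_right (- D))"
    using near
  proof eventually_elim
    case (elim r)
    then have r: "- dim_infty \<nu> < ereal r" "r < 0" by (auto simp: range)
    have q: "q_crit \<nu> r = ereal (Q r)" "1 < Q r" using Q elim by auto
    show ?case
      using lower_quant_dim_le[OF assms(1) r q] lower_quant_dim_ge[OF assms(1) r q]
      by (simp add: mult.commute)
  qed
  ultimately have "((\<lambda>r. lower_quant_dim N \<nu> r) \<longlongrightarrow> a_ratio (a_crit \<nu>) * ereal D) (at_right (- D))"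
    by (rule Lim_transform_eventually)
  moreover have "ereal D \<le> a_ratio (a_crit \<nu>) * ereal D"
    using ereal_mult_right_mono[OF one_le_a_ratio[OF a1], of "ereal D"] D(2) by simp
  ultimately show ?thesis using D(1) by auto
qed

end
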